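(* For any $C\in\mathbb{A}$, the Dirac map $$\delta_{y(C)}: y(C)\longrightarrow (y(C)\pitchfork R)\pitchfork_{R}R$$ is an isomorphism in $\mathcal{E}$.
   Context: Let $\mathbb{T}$ be a finitary algebraic theory, and let $\mathbb{A}$ be a small full subcategory of the category of $\mathbb{T}$-algebras (in sets), closed under finite coproducts of $\mathbb{T}$-algebras (for instance, the category of finitely presented $\mathbb{T}$-algebras). Let $\mathcal{E}=[\mathbb{A},\mathrm{Set}]$ be the topos of covariant functors $\mathbb{A}\to\mathrm{Set}$. Write $[C,B]$ for the set of morphisms $C\to B$ in $\mathbb{A}$, and $y(C)=[C,-]\in\mathcal{E}$ for the representable functor. $R\in\mathcal{E}$ is the forgetful functor $\mathbb{A}\to\mathrm{Set}$, $R(B)=B$; it is a $\mathbb{T}$-algebra object in $\mathcal{E}$ (with the $\mathbb{T}$-structure of each $B$). Notation: $Q\pitchfork Z$ denotes the exponential object $Z^{Q}$ in $\mathcal{E}$. An $R$-algebra in $\mathcal{E}$ is a $\mathbb{T}$-algebra $X$ in $\mathcal{E}$ equipped with a $\mathbb{T}$-homomorphism $R\to X$ (its structure map), and morphisms of $R$-algebras are $\mathbb{T}$-homomorphisms commuting with the structure maps; $R$ is itself an $R$-algebra via the identity. For $R$-algebras $X,Z$, $X\pitchfork_{R}Z\subseteq X\pitchfork Z$ is the subobject of $R$-algebra morphisms: a map $P\to X\pitchfork Z$ factors through it iff the corresponding map $P\times X\to Z$ is an $R$-algebra morphism in the variable $X$ (i.e. in the internal sense it preserves, for each fixed value of the $P$-variable,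 all $\mathbb{T}$-operations and the structure map from $R$). For any $S\in\mathcal{E}$, $S\pitchfork R$ is a $\mathbb{T}$-algebra with the pointwise structure inherited from $R$, and an $R$-algebra via the map $R\to S\pitchfork R$ that is the exponential transpose of the projection $R\times S\to R$. For $S\in\mathcal{E}$, $\delta_{S}:S\to (S\pitchfork R)\pitchfork_{R}R$ is the exponential transpose of the evaluation map $(S\pitchfork R)\times S\to R$; it takes values in $(S\pitchfork R)\pitchfork_R R\subseteq (S\pitchfork R)\pitchfork R$ because evaluation is an $R$-algebra morphism in the first variable. *)

theory Defs
  imports "HOL-Library.FuncSet"
begin

section \<open>Finitary algebraic theories and their algebras\<close>

datatype 'f tm = Var nat | App 'f "'f tm list"

text \<open>
  A finitary algebraic theory is given by a presentation: a set of operation symbols, their finite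
  arities, and a set of equations between terms. The operation symbols form a set rather than a
  whole type so that theories without operations are included.
\<close>

record 'f alg_theory =
  ops :: "'f set"
  arity :: "'f \<Rightarrow> nat"
  eqns :: "('f tm \<times> 'f tm) set"

fun wf_tm :: "'f alg_theory \<Rightarrow> 'f tm \<Rightarrow> bool" where
  "wf_tm T (Var n) \<longleftrightarrow> True"
| "wf_tm T (App f ts) \<longleftrightarrow> f \<in> ops T \<and> length ts = arity T f \<and> (\<forall>t\<in>set ts. wf_tm T t)"

definition wf_theory :: "'f alg_theory \<Rightarrow> bool" where
  "wf_theory T \<longleftrightarrow> (\<forall>(s, t)\<in>eqns T. wf_tm T s \<and> wf_tm T t)"

text \<open>
  The type \<open>'a\<close> is the universe from which the elements of all algebras are taken. The carrier is
  a set and may be empty.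
\<close>

record ('f, 'a) alg =
  carrier :: "'a set"
  oper :: "'f \<Rightarrow> 'a list \<Rightarrow> 'a"

primrec tm_val :: "('f, 'a) alg \<Rightarrow> (nat \<Rightarrow> 'a) \<Rightarrow> 'f tm \<Rightarrow> 'a" where
  "tm_val M \<rho> (Var n) = \<rho> n"
| "tm_val M \<rho> (App f ts) = oper M f (map (tm_val M \<rho>) ts)"

definition args :: "'f alg_theory \<Rightarrow> 'f \<Rightarrow> 'x set \<Rightarrow> 'x list set" where
  "args T f X = {xs. set xs \<subseteq> X \<and> length xs = arity T f}"

definition is_talg :: "'f alg_theory \<Rightarrow> ('f, 'a) alg \<Rightarrow> bool" where
  "is_talg T M \<longleftrightarrow>
     (\<forall>f\<in>ops T. \<forall>xs\<in>args T f (carrier M). oper M f xs \<in> carrier M) \<and>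
     (\<forall>(s, t)\<in>eqns T. \<forall>\<rho>. range \<rho> \<subseteq> carrier M \<longrightarrow> tm_val M \<rho> s = tm_val M \<rho> t)"

text \<open>
  Homomorphisms are extensional functions (undefined outside the carrier), so that equality of
  morphisms is equality in HOL.
\<close>

definition hom :: "'f alg_theory \<Rightarrow> ('f, 'a) alg \<Rightarrow> ('f, 'b) alg \<Rightarrow> ('a \<Rightarrow> 'b) set" where
  "hom T M N = {h \<in> carrier M \<rightarrow>\<^sub>E carrier N.
     \<forall>f\<in>ops T. \<forall>xs\<in>args T f (carrier M). h (oper M f xs) = oper N f (map h xs)}"

definition ident :: "('f, 'a) alg \<Rightarrow> 'a \<Rightarrow> 'a" where
  "ident M = (\<lambda>x\<in>carrier M. x)"

text \<open>
  \<open>P\<close> with injections \<open>\<iota> 0, \<iota> 1, \<dots>\<close> is a coproduct of the finite family \<open>Bs\<close> in the category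
  of all \<open>T\<close>-algebras (with elements in \<open>'a\<close>); for the empty family this says that \<open>P\<close> is initial.
  A coproduct among algebras of arbitrary element type is in particular one in this sense.
\<close>

definition is_coproduct ::
  "'f alg_theory \<Rightarrow> ('f, 'a) alg list \<Rightarrow> ('f, 'a) alg \<Rightarrow> (nat \<Rightarrow> 'a \<Rightarrow> 'a) \<Rightarrow> bool" where
  "is_coproduct T Bs P \<iota> \<longleftrightarrow>
     is_talg T P \<and> (\<forall>i<length Bs. \<iota> i \<in> hom T (Bs ! i) P) \<and>
     (\<forall>(D :: ('f, 'a) alg) g. is_talg T D \<and> (\<forall>i<length Bs. g i \<in> hom T (Bs ! i) D) \<longrightarrow>
        (\<exists>!h. h \<in> hom T P D \<and>
           (\<forall>i<length Bs. compose (carrier (Bs ! i)) h (\<iota> i) = g i)))"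

definition closed_under_finite_coproducts ::
  "'f alg_theory \<Rightarrow> ('f, 'a) alg set \<Rightarrow> bool" where
  "closed_under_finite_coproducts T A \<longleftrightarrow>
     (\<forall>Bs. set Bs \<subseteq> A \<longrightarrow> (\<exists>P\<in>A. \<exists>\<iota>. is_coproduct T Bs P \<iota>))"


section \<open>Set-valued functors on a full subcategory of algebras\<close>

text \<open>
  A full subcategory is given by its set \<open>A\<close> of objects. In \<open>fmap F B D h\<close> the morphism \<open>h\<close> goes
  from \<open>B\<close> to \<open>D\<close>. Only the values on objects in \<open>A\<close>, morphisms between them and elements of
  \<open>fob F B\<close> are meaningful.
\<close>

record ('f, 'a, 'x) set_functor =
  fob :: "('f, 'a) alg \<Rightarrow> 'x set"
  fmap :: "('f, 'a) alg \<Rightarrow> ('f, 'a) alg \<Rightarrow> ('a \<Rightarrow> 'a) \<Rightarrow> 'x \<Rightarrow> 'x"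

definition is_functor ::
  "'f alg_theory \<Rightarrow> ('f, 'a) alg set \<Rightarrow> ('f, 'a, 'x, 'm) set_functor_scheme \<Rightarrow> bool" where
  "is_functor T A F \<longleftrightarrow>
     (\<forall>B\<in>A. \<forall>D\<in>A. \<forall>h\<in>hom T B D. \<forall>x\<in>fob F B. fmap F B D h x \<in> fob F D) \<and>
     (\<forall>B\<in>A. \<forall>x\<in>fob F B. fmap F B B (ident B) x = x) \<and>
     (\<forall>B\<in>A. \<forall>D\<in>A. \<forall>E\<in>A. \<forall>h\<in>hom T B D. \<forall>k\<in>hom T D E. \<forall>x\<in>fob F B.
        fmap F B E (compose (carrier B) k h) x = fmap F D E k (fmap F B D h x))"

text \<open>The set of morphisms \<open>F \<rightarrow> G\<close> in the functor category, again as extensional families.\<close>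

definition nat_trans ::
  "'f alg_theory \<Rightarrow> ('f, 'a) alg set \<Rightarrow> ('f, 'a, 'x, 'm) set_functor_scheme \<Rightarrow>
   ('f, 'a, 'y, 'n) set_functor_scheme \<Rightarrow> (('f, 'a) alg \<Rightarrow> 'x \<Rightarrow> 'y) set" where
  "nat_trans T A F G = {\<eta> \<in> (\<Pi>\<^sub>E B\<in>A. fob F B \<rightarrow>\<^sub>E fob G B).
     \<forall>B\<in>A. \<forall>D\<in>A. \<forall>h\<in>hom T B D. \<forall>x\<in>fob F B.
       \<eta> D (fmap F B D h x) = fmap G B D h (\<eta> B x)}"

definition nt_id ::
  "('f, 'a) alg set \<Rightarrow> ('f, 'a, 'x, 'm) set_functor_scheme \<Rightarrow> ('f, 'a) alg \<Rightarrow> 'x \<Rightarrow> 'x" where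
  "nt_id A F = (\<lambda>B\<in>A. \<lambda>x\<in>fob F B. x)"

definition nt_comp ::
  "('f, 'a) alg set \<Rightarrow> ('f, 'a, 'x, 'm) set_functor_scheme \<Rightarrow> (('f, 'a) alg \<Rightarrow> 'y \<Rightarrow> 'z) \<Rightarrow>
   (('f, 'a) alg \<Rightarrow> 'x \<Rightarrow> 'y) \<Rightarrow> ('f, 'a) alg \<Rightarrow> 'x \<Rightarrow> 'z" where
  "nt_comp A F \<theta> \<eta> = (\<lambda>B\<in>A. \<lambda>x\<in>fob F B. \<theta> B (\<eta> B x))"

definition is_iso ::
  "'f alg_theory \<Rightarrow> ('f, 'a) alg set \<Rightarrow> ('f, 'a, 'x, 'm) set_functor_scheme \<Rightarrow>
   ('f, 'a, 'y, 'n) set_functor_scheme \<Rightarrow> (('f, 'a) alg \<Rightarrow> 'x \<Rightarrow> 'y) \<Rightarrow> bool" where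
  "is_iso T A F G \<eta> \<longleftrightarrow> \<eta> \<in> nat_trans T A F G \<and>
     (\<exists>\<theta>\<in>nat_trans T A G F. nt_comp A F \<theta> \<eta> = nt_id A F \<and> nt_comp A G \<eta> \<theta> = nt_id A G)"

definition yoneda ::
  "'f alg_theory \<Rightarrow> ('f, 'a) alg \<Rightarrow> ('f, 'a, 'a \<Rightarrow> 'a) set_functor" where
  "yoneda T C = \<lparr>fob = (\<lambda>B. hom T C B), fmap = (\<lambda>B D h g. compose (carrier C) h g)\<rparr>"

definition fprod ::
  "('f, 'a, 'x, 'm) set_functor_scheme \<Rightarrow> ('f, 'a, 'y, 'n) set_functor_scheme \<Rightarrow>
   ('f, 'a, 'x \<times> 'y) set_functor" where
  "fprod P Q = \<lparr>fob = (\<lambda>B. fob P B \<times> fob Q B),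
     fmap = (\<lambda>B D h (p, q). (fmap P B D h p, fmap Q B D h q))\<rparr>"


section \<open>Exponentials\<close>

text \<open>
  The exponential \<open>Q \<pitchfork> Z\<close> by the usual formula \<open>(Q \<pitchfork> Z)(B) = Nat(y(B) \<times> Q, Z)\<close>. Its universal
  property is lemma \<open>exponential_universal\<close> below.
\<close>

definition pitchfork ::
  "'f alg_theory \<Rightarrow> ('f, 'a) alg set \<Rightarrow> ('f, 'a, 'q, 'm) set_functor_scheme \<Rightarrow>
   ('f, 'a, 'z, 'n) set_functor_scheme \<Rightarrow>
   ('f, 'a, ('f, 'a) alg \<Rightarrow> ('a \<Rightarrow> 'a) \<times> 'q \<Rightarrow> 'z) set_functor" where
  "pitchfork T A Q Z = \<lparr>
     fob = (\<lambda>B. nat_trans T A (fprod (yoneda T B) Q) Z),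
     fmap = (\<lambda>B D h \<phi>. \<lambda>E\<in>A. \<lambda>(k, q)\<in>hom T D E \<times> fob Q E. \<phi> E (compose (carrier B) k h, q))\<rparr>"

definition evaluation ::
  "'f alg_theory \<Rightarrow> ('f, 'a) alg set \<Rightarrow> ('f, 'a, 'q, 'm) set_functor_scheme \<Rightarrow>
   ('f, 'a, 'z, 'n) set_functor_scheme \<Rightarrow>
   ('f, 'a) alg \<Rightarrow> (('f, 'a) alg \<Rightarrow> ('a \<Rightarrow> 'a) \<times> 'q \<Rightarrow> 'z) \<times> 'q \<Rightarrow> 'z" where
  "evaluation T A Q Z =
     (\<lambda>B\<in>A. \<lambda>(\<phi>, q)\<in>fob (pitchfork T A Q Z) B \<times> fob Q B. \<phi> B (ident B, q))"

text \<open>The exponential transpose \<open>P \<rightarrow> Q \<pitchfork> Z\<close> of \<open>\<tau> : P \<times> Q \<rightarrow> Z\<close>.\<close>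

definition exp_transpose ::
  "'f alg_theory \<Rightarrow> ('f, 'a) alg set \<Rightarrow> ('f, 'a, 'p, 'm) set_functor_scheme \<Rightarrow>
   ('f, 'a, 'q, 'n) set_functor_scheme \<Rightarrow> (('f, 'a) alg \<Rightarrow> 'p \<times> 'q \<Rightarrow> 'z) \<Rightarrow>
   ('f, 'a) alg \<Rightarrow> 'p \<Rightarrow> ('f, 'a) alg \<Rightarrow> ('a \<Rightarrow> 'a) \<times> 'q \<Rightarrow> 'z" where
  "exp_transpose T A P Q \<tau> = (\<lambda>B\<in>A. \<lambda>p\<in>fob P B. \<lambda>E\<in>A. \<lambda>(k, q)\<in>hom T B E \<times> fob Q E.
     \<tau> E (fmap P B E k p, q))"


section \<open>Algebras in the functor category\<close>

text \<open>
  Limits of functors are computed objectwise, so a \<open>T\<close>-algebra in the functor category is a functor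
  with a \<open>T\<close>-algebra structure on each value such that all transition maps are homomorphisms
  (that is, the operations are natural).
\<close>

record ('f, 'a, 'x) talg_functor = "('f, 'a, 'x) set_functor" +
  fop :: "('f, 'a) alg \<Rightarrow> 'f \<Rightarrow> 'x list \<Rightarrow> 'x"

text \<open>\<open>fstr X B\<close> is the component at \<open>B\<close> of the structure map \<open>R \<rightarrow> X\<close>; recall \<open>R(B) = B\<close>.\<close>

record ('f, 'a, 'x) ralg = "('f, 'a, 'x) talg_functor" +
  fstr :: "('f, 'a) alg \<Rightarrow> 'a \<Rightarrow> 'x"

definition stage ::
  "('f, 'a, 'x, 'm) talg_functor_scheme \<Rightarrow> ('f, 'a) alg \<Rightarrow> ('f, 'x) alg" where
  "stage X B = \<lparr>carrier = fob X B, oper = fop X B\<rparr>"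

definition is_talg_functor ::
  "'f alg_theory \<Rightarrow> ('f, 'a) alg set \<Rightarrow> ('f, 'a, 'x, 'm) talg_functor_scheme \<Rightarrow> bool" where
  "is_talg_functor T A X \<longleftrightarrow> is_functor T A X \<and> (\<forall>B\<in>A. is_talg T (stage X B)) \<and>
     (\<forall>B\<in>A. \<forall>D\<in>A. \<forall>h\<in>hom T B D. restrict (fmap X B D h) (fob X B) \<in> hom T (stage X B) (stage X D))"

definition R_alg :: "('f, 'a, 'a) ralg" where
  "R_alg = \<lparr>fob = carrier, fmap = (\<lambda>B D h. h), fop = oper, fstr = (\<lambda>B r. r)\<rparr>"

definition is_ralg ::
  "'f alg_theory \<Rightarrow> ('f, 'a) alg set \<Rightarrow> ('f, 'a, 'x, 'm) ralg_scheme \<Rightarrow> bool" where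
  "is_ralg T A X \<longleftrightarrow> is_talg_functor T A X \<and>
     (\<lambda>B\<in>A. restrict (fstr X B) (carrier B)) \<in> nat_trans T A (R_alg :: ('f, 'a, 'a) ralg) X \<and>
     (\<forall>B\<in>A. restrict (fstr X B) (carrier B) \<in> hom T B (stage X B))"

text \<open>
  \<open>\<tau> : P \<times> X \<rightarrow> Z\<close> is an \<open>R\<close>-algebra morphism in the variable \<open>X\<close>: the diagrams on
  \<open>P \<times> X \<times> \<dots> \<times> X\<close> and on \<open>P \<times> R\<close> expressing preservation of the operations and of the structure
  map commute.
\<close>

definition ralg_morphism_in_snd ::
  "'f alg_theory \<Rightarrow> ('f, 'a) alg set \<Rightarrow> ('f, 'a, 'p, 'k) set_functor_scheme \<Rightarrow>
   ('f, 'a, 'x, 'm) ralg_scheme \<Rightarrow> ('f, 'a, 'z, 'n) ralg_scheme \<Rightarrow>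
   (('f, 'a) alg \<Rightarrow> 'p \<times> 'x \<Rightarrow> 'z) \<Rightarrow> bool" where
  "ralg_morphism_in_snd T A P X Z \<tau> \<longleftrightarrow> (\<forall>E\<in>A. \<forall>p\<in>fob P E.
     (\<forall>f\<in>ops T. \<forall>xs\<in>args T f (fob X E).
        \<tau> E (p, fop X E f xs) = fop Z E f (map (\<lambda>x. \<tau> E (p, x)) xs)) \<and>
     (\<forall>r\<in>carrier E. \<tau> E (p, fstr X E r) = fstr Z E r))"

text \<open>
  The subobject \<open>X \<pitchfork>\<^sub>R Z\<close> of \<open>X \<pitchfork> Z\<close>. By Yoneda, elements of \<open>(X \<pitchfork> Z)(B)\<close> are maps
  \<open>y(B) \<rightarrow> X \<pitchfork> Z\<close>, so its elements at \<open>B\<close> are found by taking \<open>P = y(B)\<close> in the factorization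
  property; the property for arbitrary \<open>P\<close> is lemma \<open>factors_through_pitchfork_R_iff\<close> below.
\<close>

definition pitchfork_R ::
  "'f alg_theory \<Rightarrow> ('f, 'a) alg set \<Rightarrow> ('f, 'a, 'x, 'm) ralg_scheme \<Rightarrow>
   ('f, 'a, 'z, 'n) ralg_scheme \<Rightarrow>
   ('f, 'a, ('f, 'a) alg \<Rightarrow> ('a \<Rightarrow> 'a) \<times> 'x \<Rightarrow> 'z) set_functor" where
  "pitchfork_R T A X Z = \<lparr>
     fob = (\<lambda>B. {\<phi> \<in> fob (pitchfork T A X Z) B. ralg_morphism_in_snd T A (yoneda T B) X Z \<phi>}),
     fmap = fmap (pitchfork T A X Z)\<rparr>"

text \<open>
  The \<open>R\<close>-algebra \<open>S \<pitchfork> R\<close>, with pointwise operations; its structure map is the transpose of the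
  projection \<open>R \<times> S \<rightarrow> R\<close>.
\<close>

definition fun_alg ::
  "'f alg_theory \<Rightarrow> ('f, 'a) alg set \<Rightarrow> ('f, 'a, 's, 'm) set_functor_scheme \<Rightarrow>
   ('f, 'a, ('f, 'a) alg \<Rightarrow> ('a \<Rightarrow> 'a) \<times> 's \<Rightarrow> 'a) ralg" where
  "fun_alg T A S = \<lparr>
     fob = fob (pitchfork T A S (R_alg :: ('f, 'a, 'a) ralg)),
     fmap = fmap (pitchfork T A S (R_alg :: ('f, 'a, 'a) ralg)),
     fop = (\<lambda>B f \<phi>s. \<lambda>E\<in>A. \<lambda>(k, s)\<in>hom T B E \<times> fob S E. oper E f (map (\<lambda>\<phi>. \<phi> E (k, s)) \<phi>s)),
     fstr = exp_transpose T A (R_alg :: ('f, 'a, 'a) ralg) S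
       (\<lambda>B\<in>A. \<lambda>(r, s)\<in>carrier B \<times> fob S B. r)\<rparr>"

text \<open>The Dirac map: the transpose of evaluation, with the variables exchanged so as to be a map
  \<open>S \<times> (S \<pitchfork> R) \<rightarrow> R\<close>.\<close>

definition dirac ::
  "'f alg_theory \<Rightarrow> ('f, 'a) alg set \<Rightarrow> ('f, 'a, 's, 'm) set_functor_scheme \<Rightarrow>
   ('f, 'a) alg \<Rightarrow> 's \<Rightarrow> ('f, 'a) alg \<Rightarrow>
   ('a \<Rightarrow> 'a) \<times> (('f, 'a) alg \<Rightarrow> ('a \<Rightarrow> 'a) \<times> 's \<Rightarrow> 'a) \<Rightarrow> 'a" where
  "dirac T A S = exp_transpose T A S (fun_alg T A S)
     (\<lambda>B\<in>A. \<lambda>(s, \<phi>)\<in>fob S B \<times> fob (fun_alg T A S) B.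
        evaluation T A S (R_alg :: ('f, 'a, 'a) ralg) B (\<phi>, s))"

section \<open>Well-definedness of the constructions\<close>

lemma ident_hom:
  assumes B: "is_talg T B"
  shows "ident B \<in> hom T B B"
proof -
  have "ident B (oper B f xs) = oper B f (map (ident B) xs)"
    if "f \<in> ops T" and xs: "xs \<in> args T f (carrier B)" for f xs
  proof -
    have "map (ident B) xs = xs" using xs by (intro map_idI) (auto simp: args_def ident_def)
    moreover have "oper B f xs \<in> carrier B" using B that by (auto simp: is_talg_def)
    ultimately show ?thesis by (simp add: ident_def)
  qed
  then show ?thesis by (auto simp: hom_def ident_def)
qed

lemma compose_hom:
  assumes h: "h \<in> hom T B D" and k: "k \<in> hom T D E" and B: "is_talg T B"
  shows "compose (carrier B) k h \<in> hom T B E"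
proof -
  have hc: "h x \<in> carrier D" if "x \<in> carrier B" for x
    using h that by (auto simp: hom_def)
  have kc: "k x \<in> carrier E" if "x \<in> carrier D" for x
    using k that by (auto simp: hom_def)
  have "compose (carrier B) k h (oper B f xs) = oper E f (map (compose (carrier B) k h) xs)"
    if f: "f \<in> ops T" and xs: "xs \<in> args T f (carrier B)" for f xs
  proof -
    have 1: "oper B f xs \<in> carrier B" using B f xs by (auto simp: is_talg_def)
    have 2: "h (oper B f xs) = oper D f (map h xs)" using h f xs by (auto simp: hom_def)
    have 3: "map h xs \<in> args T f (carrier D)" using xs hc by (auto simp: args_def)
    have 4: "k (oper D f (map h xs)) = oper E f (map k (map h xs))"
      using k f 3 unfolding hom_def by blast
    have 5: "map (compose (carrier B) k h) xs = map k (map h xs)"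
      using xs by (auto simp: args_def compose_def)
    show ?thesis unfolding 5 compose_eq[OF 1] 2 4 ..
  qed
  moreover have "compose (carrier B) k h \<in> carrier B \<rightarrow>\<^sub>E carrier E"
    using hc kc by (auto simp: compose_def)
  ultimately show ?thesis by (auto simp: hom_def)
qed

lemma compose_ident_right: "h \<in> hom T B D \<Longrightarrow> compose (carrier B) h (ident B) = h"
  by (auto simp: hom_def compose_def ident_def PiE_def extensional_def fun_eq_iff)

lemma compose_ident_left: "h \<in> hom T B D \<Longrightarrow> compose (carrier B) (ident D) h = h"
  by (auto simp: hom_def compose_def ident_def PiE_def extensional_def fun_eq_iff)

lemma compose_assoc_hom:
  "h \<in> hom T B D \<Longrightarrow>
   compose (carrier B) l (compose (carrier B) k h) = compose (carrier B) (compose (carrier D) l k) h"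
  by (auto simp: hom_def compose_def fun_eq_iff)

lemma yoneda_functor:
  assumes "\<And>B. B \<in> A \<Longrightarrow> is_talg T B" and "C \<in> A"
  shows "is_functor T A (yoneda T C)"
  unfolding is_functor_def yoneda_def
  by (auto simp: compose_hom assms compose_ident_left compose_assoc_hom)

lemma fprod_functor:
  "is_functor T A P \<Longrightarrow> is_functor T A Q \<Longrightarrow> is_functor T A (fprod P Q)"
  unfolding is_functor_def fprod_def by auto

lemma nat_transI:
  assumes "\<And>B. B \<in> A \<Longrightarrow> \<eta> B \<in> fob F B \<rightarrow>\<^sub>E fob G B"
    and "\<And>B. B \<notin> A \<Longrightarrow> \<eta> B = undefined"
    and "\<And>B D h x. B \<in> A \<Longrightarrow> D \<in> A \<Longrightarrow> h \<in> hom T B D \<Longrightarrow> x \<in> fob F B \<Longrightarrow>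
           \<eta> D (fmap F B D h x) = fmap G B D h (\<eta> B x)"
  shows "\<eta> \<in> nat_trans T A F G"
  using assms unfolding nat_trans_def PiE_def extensional_def by blast

lemma nat_trans_mem:
  "\<eta> \<in> nat_trans T A F G \<Longrightarrow> B \<in> A \<Longrightarrow> x \<in> fob F B \<Longrightarrow> \<eta> B x \<in> fob G B"
  unfolding nat_trans_def by (auto dest: PiE_mem)

lemma nat_trans_natural:
  "\<eta> \<in> nat_trans T A F G \<Longrightarrow> B \<in> A \<Longrightarrow> D \<in> A \<Longrightarrow> h \<in> hom T B D \<Longrightarrow> x \<in> fob F B \<Longrightarrow>
   \<eta> D (fmap F B D h x) = fmap G B D h (\<eta> B x)"
  unfolding nat_trans_def by auto

lemma nat_trans_eqI:
  assumes "\<eta> \<in> nat_trans T A F G" "\<theta> \<in> nat_trans T A F G'"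
    and "\<And>B x. B \<in> A \<Longrightarrow> x \<in> fob F B \<Longrightarrow> \<eta> B x = \<theta> B x"
  shows "\<eta> = \<theta>"
proof
  fix B
  show "\<eta> B = \<theta> B"
  proof (cases "B \<in> A")
    case True
    then have "\<eta> B \<in> extensional (fob F B)" "\<theta> B \<in> extensional (fob F B)"
      using assms(1,2) unfolding nat_trans_def by (auto simp: PiE_def Pi_def)
    then show ?thesis using assms(3) True by (auto intro: extensionalityI)
  next
    case False
    then show ?thesis using assms(1,2) unfolding nat_trans_def by (auto simp: PiE_def extensional_def)
  qed
qed

lemma fprod_simps [simp]:
  "fob (fprod P Q) B = fob P B \<times> fob Q B"
  "fmap (fprod P Q) B D h (p, q) = (fmap P B D h p, fmap Q B D h q)"
  by (auto simp: fprod_def)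

lemma yoneda_simps [simp]:
  "fob (yoneda T C) B = hom T C B"
  "fmap (yoneda T C) B D h g = compose (carrier C) h g"
  by (auto simp: yoneda_def)

lemma R_alg_simps [simp]:
  "fob R_alg = carrier" "fmap R_alg B D h = h" "fop R_alg = oper" "fstr R_alg B r = r"
  by (auto simp: R_alg_def)

lemma pitchfork_fmap:
  "E \<in> A \<Longrightarrow> k \<in> hom T D E \<Longrightarrow> q \<in> fob Q E \<Longrightarrow>
   fmap (pitchfork T A Q Z) B D h \<phi> E (k, q) = \<phi> E (compose (carrier B) k h, q)"
  by (simp add: pitchfork_def)

locale algebra_subcategory =
  fixes T :: "'f alg_theory" and A :: "('f, 'a) alg set"
  assumes wf: "wf_theory T"
    and alg: "\<And>B. B \<in> A \<Longrightarrow> is_talg T B"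
begin

lemma pitchfork_map_mem:
  assumes Q: "is_functor T A Q"
    and B: "B \<in> A" and D: "D \<in> A" and h: "h \<in> hom T B D" and \<phi>: "\<phi> \<in> fob (pitchfork T A Q Z) B"
  shows "fmap (pitchfork T A Q Z) B D h \<phi> \<in> fob (pitchfork T A Q Z) D"
proof -
  have \<phi>': "\<phi> \<in> nat_trans T A (fprod (yoneda T B) Q) Z" using \<phi> by (simp add: pitchfork_def)
  have "fmap (pitchfork T A Q Z) B D h \<phi> \<in> nat_trans T A (fprod (yoneda T D) Q) Z"
  proof (rule nat_transI)
    fix E assume E: "E \<in> A"
    show "fmap (pitchfork T A Q Z) B D h \<phi> E \<in> fob (fprod (yoneda T D) Q) E \<rightarrow>\<^sub>E fob Z E"
      using nat_trans_mem[OF \<phi>' E] compose_hom[OF h _ alg[OF B]] E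
      by (auto simp: pitchfork_def)
  next
    fix E assume "E \<notin> A"
    then show "fmap (pitchfork T A Q Z) B D h \<phi> E = undefined" by (simp add: pitchfork_def)
  next
    fix E G l x assume E: "E \<in> A" and G: "G \<in> A" and l: "l \<in> hom T E G"
      and x: "x \<in> fob (fprod (yoneda T D) Q) E"
    obtain k q where x': "x = (k, q)" "k \<in> hom T D E" "q \<in> fob Q E" using x by auto
    have kh: "compose (carrier B) k h \<in> hom T B E" using compose_hom[OF h x'(2) alg[OF B]] .
    have q: "fmap Q E G l q \<in> fob Q G" using Q E G l x' unfolding is_functor_def by blast
    have lk: "compose (carrier D) l k \<in> hom T D G" using compose_hom[OF x'(2) l alg[OF D]] .
    show "fmap (pitchfork T A Q Z) B D h \<phi> G (fmap (fprod (yoneda T D) Q) E G l x) =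
        fmap Z E G l (fmap (pitchfork T A Q Z) B D h \<phi> E x)"
      using nat_trans_natural[OF \<phi>' E G l, of "(compose (carrier B) k h, q)"]
      by (simp add: x' pitchfork_fmap E G q lk kh compose_assoc_hom[OF h])
  qed
  then show ?thesis by (simp add: pitchfork_def)
qed

lemma pitchfork_elt_eqI:
  assumes "\<phi> \<in> fob (pitchfork T A Q Z) B" "\<psi> \<in> fob (pitchfork T A Q Z) B"
    and "\<And>E k q. E \<in> A \<Longrightarrow> k \<in> hom T B E \<Longrightarrow> q \<in> fob Q E \<Longrightarrow> \<phi> E (k, q) = \<psi> E (k, q)"
  shows "\<phi> = \<psi>"
proof (rule nat_trans_eqI)
  show "\<phi> \<in> nat_trans T A (fprod (yoneda T B) Q) Z" "\<psi> \<in> nat_trans T A (fprod (yoneda T B) Q) Z"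
    using assms(1,2) by (simp_all add: pitchfork_def)
qed (use assms(3) in auto)

lemma pitchfork_functor:
  assumes Q: "is_functor T A Q"
  shows "is_functor T A (pitchfork T A Q Z)"
  unfolding is_functor_def
proof (intro conjI ballI)
  fix B D h \<phi> assume "B \<in> A" "D \<in> A" "h \<in> hom T B D" "\<phi> \<in> fob (pitchfork T A Q Z) B"
  then show "fmap (pitchfork T A Q Z) B D h \<phi> \<in> fob (pitchfork T A Q Z) D"
    by (rule pitchfork_map_mem[OF Q])
next
  fix B \<phi> assume B: "B \<in> A" and \<phi>: "\<phi> \<in> fob (pitchfork T A Q Z) B"
  show "fmap (pitchfork T A Q Z) B B (ident B) \<phi> = \<phi>"
    by (rule pitchfork_elt_eqI[OF pitchfork_map_mem[OF Q B B ident_hom[OF alg[OF B]] \<phi>] \<phi>])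
      (simp add: pitchfork_fmap compose_ident_right)
next
  fix B D E h k \<phi>
  assume B: "B \<in> A" and D: "D \<in> A" and E: "E \<in> A" and h: "h \<in> hom T B D" and k: "k \<in> hom T D E"
    and \<phi>: "\<phi> \<in> fob (pitchfork T A Q Z) B"
  note kh = compose_hom[OF h k alg[OF B]]
  show "fmap (pitchfork T A Q Z) B E (compose (carrier B) k h) \<phi> =
    fmap (pitchfork T A Q Z) D E k (fmap (pitchfork T A Q Z) B D h \<phi>)"
    by (rule pitchfork_elt_eqI[OF pitchfork_map_mem[OF Q B E kh \<phi>]
          pitchfork_map_mem[OF Q D E k pitchfork_map_mem[OF Q B D h \<phi>]]])
      (simp add: pitchfork_fmap compose_hom[OF k _ alg[OF D]] compose_assoc_hom[OF h])
qed

lemma exp_transpose_apply: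
  "B \<in> A \<Longrightarrow> p \<in> fob P B \<Longrightarrow> E \<in> A \<Longrightarrow> k \<in> hom T B E \<Longrightarrow> q \<in> fob Q E \<Longrightarrow>
   exp_transpose T A P Q \<tau> B p E (k, q) = \<tau> E (fmap P B E k p, q)"
  by (simp add: exp_transpose_def)

lemma exp_transpose_elt:
  assumes P: "is_functor T A P" and Q: "is_functor T A Q"
    and \<tau>: "\<tau> \<in> nat_trans T A (fprod P Q) Z" and B: "B \<in> A" and p: "p \<in> fob P B"
  shows "exp_transpose T A P Q \<tau> B p \<in> fob (pitchfork T A Q Z) B"
proof -
  have Pm: "fmap P B E k p \<in> fob P E" if "E \<in> A" "k \<in> hom T B E" for E k
    using P that B p unfolding is_functor_def by blast
  have "exp_transpose T A P Q \<tau> B p \<in> nat_trans T A (fprod (yoneda T B) Q) Z"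
  proof (rule nat_transI)
    fix E assume E: "E \<in> A"
    show "exp_transpose T A P Q \<tau> B p E \<in> fob (fprod (yoneda T B) Q) E \<rightarrow>\<^sub>E fob Z E"
      using nat_trans_mem[OF \<tau> E] Pm[OF E] E B p by (auto simp: exp_transpose_def)
  next
    fix E assume "E \<notin> A"
    then show "exp_transpose T A P Q \<tau> B p E = undefined" using B p by (simp add: exp_transpose_def)
  next
    fix E G l x assume E: "E \<in> A" and G: "G \<in> A" and l: "l \<in> hom T E G"
      and x: "x \<in> fob (fprod (yoneda T B) Q) E"
    obtain k q where x': "x = (k, q)" "k \<in> hom T B E" "q \<in> fob Q E" using x by auto
    have q: "fmap Q E G l q \<in> fob Q G" using Q E G l x' unfolding is_functor_def by blast
    have lk: "compose (carrier B) l k \<in> hom T B G" using compose_hom[OF x'(2) l alg[OF B]] .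
    have "fmap P B G (compose (carrier B) l k) p = fmap P E G l (fmap P B E k p)"
      using P B E G x'(2) l p unfolding is_functor_def by blast
    then show "exp_transpose T A P Q \<tau> B p G (fmap (fprod (yoneda T B) Q) E G l x) =
        fmap Z E G l (exp_transpose T A P Q \<tau> B p E x)"
      using nat_trans_natural[OF \<tau> E G l, of "(fmap P B E k p, q)"] Pm[OF E x'(2)]
      by (simp add: x' exp_transpose_apply B p E G q lk)
  qed
  then show ?thesis by (simp add: pitchfork_def)
qed

lemma exp_transpose_nat_trans:
  assumes P: "is_functor T A P" and Q: "is_functor T A Q"
    and \<tau>: "\<tau> \<in> nat_trans T A (fprod P Q) Z"
  shows "exp_transpose T A P Q \<tau> \<in> nat_trans T A P (pitchfork T A Q Z)"
proof (rule nat_transI)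
  fix B assume B: "B \<in> A"
  then show "exp_transpose T A P Q \<tau> B \<in> fob P B \<rightarrow>\<^sub>E fob (pitchfork T A Q Z) B"
    using exp_transpose_elt[OF P Q \<tau> B] by (auto simp: exp_transpose_def)
next
  fix B assume "B \<notin> A"
  then show "exp_transpose T A P Q \<tau> B = undefined" by (simp add: exp_transpose_def)
next
  fix B D h p assume B: "B \<in> A" and D: "D \<in> A" and h: "h \<in> hom T B D" and p: "p \<in> fob P B"
  have hp: "fmap P B D h p \<in> fob P D" using P B D h p unfolding is_functor_def by blast
  show "exp_transpose T A P Q \<tau> D (fmap P B D h p) =
      fmap (pitchfork T A Q Z) B D h (exp_transpose T A P Q \<tau> B p)"
  proof (rule pitchfork_elt_eqI[OF exp_transpose_elt[OF P Q \<tau> D hp]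
        pitchfork_map_mem[OF Q B D h exp_transpose_elt[OF P Q \<tau> B p]]])
    fix E k q assume E: "E \<in> A" and k: "k \<in> hom T D E" and q: "q \<in> fob Q E"
    have "fmap P B E (compose (carrier B) k h) p = fmap P D E k (fmap P B D h p)"
      using P B D E h k p unfolding is_functor_def by blast
    then show "exp_transpose T A P Q \<tau> D (fmap P B D h p) E (k, q) =
        fmap (pitchfork T A Q Z) B D h (exp_transpose T A P Q \<tau> B p) E (k, q)"
      by (simp add: pitchfork_fmap exp_transpose_apply B D E k q hp p compose_hom[OF h k alg[OF B]])
  qed
qed

lemma evaluation_nat_trans:
  assumes Q: "is_functor T A Q"
  shows "evaluation T A Q Z \<in> nat_trans T A (fprod (pitchfork T A Q Z) Q) Z"
proof (rule nat_transI)
  fix B assume B: "B \<in> A"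
  have "\<phi> B (ident B, q) \<in> fob Z B" if "\<phi> \<in> fob (pitchfork T A Q Z) B" "q \<in> fob Q B" for \<phi> q
    using nat_trans_mem[of \<phi> T A "fprod (yoneda T B) Q" Z B "(ident B, q)"] that B
      ident_hom[OF alg[OF B]] by (simp add: pitchfork_def)
  then show "evaluation T A Q Z B \<in> fob (fprod (pitchfork T A Q Z) Q) B \<rightarrow>\<^sub>E fob Z B"
    using B by (auto simp: evaluation_def)
next
  fix B assume "B \<notin> A"
  then show "evaluation T A Q Z B = undefined" by (simp add: evaluation_def)
next
  fix B D h x assume B: "B \<in> A" and D: "D \<in> A" and h: "h \<in> hom T B D"
    and x: "x \<in> fob (fprod (pitchfork T A Q Z) Q) B"
  obtain \<phi> q where x': "x = (\<phi>, q)" "\<phi> \<in> fob (pitchfork T A Q Z) B" "q \<in> fob Q B"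
    using x by auto
  have \<phi>: "\<phi> \<in> nat_trans T A (fprod (yoneda T B) Q) Z" using x'(2) by (simp add: pitchfork_def)
  have q: "fmap Q B D h q \<in> fob Q D" using Q B D h x' unfolding is_functor_def by blast
  show "evaluation T A Q Z D (fmap (fprod (pitchfork T A Q Z) Q) B D h x) =
      fmap Z B D h (evaluation T A Q Z B x)"
    using nat_trans_natural[OF \<phi> B D h, of "(ident B, q)"]
    by (simp add: x' evaluation_def B D q pitchfork_map_mem[OF Q B D h x'(2)] pitchfork_fmap
        ident_hom alg compose_ident_left[OF h] compose_ident_right[OF h])
qed

lemma exponential_universal:
  assumes P: "is_functor T A P" and Q: "is_functor T A Q"
    and \<tau>: "\<tau> \<in> nat_trans T A (fprod P Q) Z"
  shows "\<sigma> \<in> nat_trans T A P (pitchfork T A Q Z) \<and>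
      (\<forall>B\<in>A. \<forall>p\<in>fob P B. \<forall>q\<in>fob Q B. evaluation T A Q Z B (\<sigma> B p, q) = \<tau> B (p, q))
    \<longleftrightarrow> \<sigma> = exp_transpose T A P Q \<tau>"
proof safe
  show "exp_transpose T A P Q \<tau> \<in> nat_trans T A P (pitchfork T A Q Z)"
    by (rule exp_transpose_nat_trans[OF P Q \<tau>])
next
  fix B p q assume B: "B \<in> A" and p: "p \<in> fob P B" and q: "q \<in> fob Q B"
  have "fmap P B B (ident B) p = p" using P B p unfolding is_functor_def by blast
  then show "evaluation T A Q Z B (exp_transpose T A P Q \<tau> B p, q) = \<tau> B (p, q)"
    by (simp add: evaluation_def B q exp_transpose_elt[OF P Q \<tau> B p] exp_transpose_apply p ident_hom alg)
next
  assume \<sigma>: "\<sigma> \<in> nat_trans T A P (pitchfork T A Q Z)"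
    and ev: "\<forall>B\<in>A. \<forall>p\<in>fob P B. \<forall>q\<in>fob Q B. evaluation T A Q Z B (\<sigma> B p, q) = \<tau> B (p, q)"
  show "\<sigma> = exp_transpose T A P Q \<tau>"
  proof (rule nat_trans_eqI[OF \<sigma> exp_transpose_nat_trans[OF P Q \<tau>]])
    fix B p assume B: "B \<in> A" and p: "p \<in> fob P B"
    show "\<sigma> B p = exp_transpose T A P Q \<tau> B p"
    proof (rule pitchfork_elt_eqI[OF nat_trans_mem[OF \<sigma> B p] exp_transpose_elt[OF P Q \<tau> B p]])
      fix E k q assume E: "E \<in> A" and k: "k \<in> hom T B E" and q: "q \<in> fob Q E"
      have kp: "fmap P B E k p \<in> fob P E" using P B E k p unfolding is_functor_def by blast
      have "\<tau> E (fmap P B E k p, q) = evaluation T A Q Z E (\<sigma> E (fmap P B E k p), q)"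
        using ev E kp q by simp
      also have "\<dots> = \<sigma> E (fmap P B E k p) E (ident E, q)"
        by (simp add: evaluation_def E q nat_trans_mem[OF \<sigma> E kp])
      also have "\<dots> = \<sigma> B p E (k, q)"
        by (simp add: nat_trans_natural[OF \<sigma> B E k p] pitchfork_fmap E q ident_hom alg
            compose_ident_left[OF k])
      finally show "\<sigma> B p E (k, q) = exp_transpose T A P Q \<tau> B p E (k, q)"
        by (simp add: exp_transpose_apply B p E k q)
    qed
  qed
qed

lemma R_functor: "is_functor T A (R_alg :: ('f, 'a, 'a) ralg)"
  unfolding is_functor_def by (auto simp: hom_def compose_def ident_def)

lemma R_ralg: "is_ralg T A (R_alg :: ('f, 'a, 'a) ralg)"
proof -
  have stage: "stage R_alg B = B" for B :: "('f, 'a) alg" by (simp add: stage_def)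
  have restr: "restrict h (carrier B) = h" if "h \<in> hom T B D" for h B and D :: "('f, 'a) alg"
    using that by (auto simp: hom_def PiE_def extensional_restrict)
  have idr: "restrict (fstr R_alg B) (carrier B) = ident B" for B :: "('f, 'a) alg"
    by (auto simp: ident_def)
  show ?thesis
    unfolding is_ralg_def is_talg_functor_def stage idr
  proof (intro conjI R_functor ballI)
    show "(\<lambda>B\<in>A. ident B) \<in> nat_trans T A (R_alg :: ('f, 'a, 'a) ralg) (R_alg :: ('f, 'a, 'a) ralg)"
      by (rule nat_transI) (auto simp: ident_def hom_def)
  qed (auto simp: restr alg ident_hom)
qed

lemma fun_alg_simps:
  "fob (fun_alg T A S) = fob (pitchfork T A S (R_alg :: ('f, 'a, 'a) ralg))"
  "fmap (fun_alg T A S) = fmap (pitchfork T A S (R_alg :: ('f, 'a, 'a) ralg))"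
  by (simp_all add: fun_alg_def)

lemma fop_fun_alg:
  "E \<in> A \<Longrightarrow> k \<in> hom T B E \<Longrightarrow> s \<in> fob S E \<Longrightarrow>
   fop (fun_alg T A S) B f \<phi>s E (k, s) = oper E f (map (\<lambda>\<phi>. \<phi> E (k, s)) \<phi>s)"
  by (simp add: fun_alg_def)

lemma fop_fun_alg_mem:
  assumes S: "is_functor T A S" and f: "f \<in> ops T" and B: "B \<in> A"
    and \<phi>s: "\<phi>s \<in> args T f (fob (fun_alg T A S) B)"
  shows "fop (fun_alg T A S) B f \<phi>s \<in> fob (fun_alg T A S) B"
proof -
  have \<phi>: "\<phi> \<in> nat_trans T A (fprod (yoneda T B) S) (R_alg :: ('f, 'a, 'a) ralg)"
    if "\<phi> \<in> set \<phi>s" for \<phi>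
    using \<phi>s that by (auto simp: args_def fun_alg_simps pitchfork_def)
  have arg: "map (\<lambda>\<phi>. \<phi> E (k, s)) \<phi>s \<in> args T f (carrier E)"
    if "E \<in> A" "k \<in> hom T B E" "s \<in> fob S E" for E k s
    using nat_trans_mem[OF \<phi>] that \<phi>s by (auto simp: args_def)
  have "fop (fun_alg T A S) B f \<phi>s \<in> nat_trans T A (fprod (yoneda T B) S) (R_alg :: ('f, 'a, 'a) ralg)"
  proof (rule nat_transI)
    fix E assume E: "E \<in> A"
    show "fop (fun_alg T A S) B f \<phi>s E \<in> fob (fprod (yoneda T B) S) E \<rightarrow>\<^sub>E fob (R_alg :: ('f, 'a, 'a) ralg) E"
      using arg[OF E] alg[OF E] f E by (auto simp: fun_alg_def is_talg_def)
  next
    fix E assume "E \<notin> A"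
    then show "fop (fun_alg T A S) B f \<phi>s E = undefined" by (simp add: fun_alg_def)
  next
    fix E G l x assume E: "E \<in> A" and G: "G \<in> A" and l: "l \<in> hom T E G"
      and x: "x \<in> fob (fprod (yoneda T B) S) E"
    obtain k s where x': "x = (k, s)" "k \<in> hom T B E" "s \<in> fob S E" using x by auto
    have s: "fmap S E G l s \<in> fob S G" using S E G l x' unfolding is_functor_def by blast
    have lk: "compose (carrier B) l k \<in> hom T B G" using compose_hom[OF x'(2) l alg[OF B]] .
    have "map (\<lambda>\<phi>. \<phi> G (compose (carrier B) l k, fmap S E G l s)) \<phi>s = map l (map (\<lambda>\<phi>. \<phi> E (k, s)) \<phi>s)"
      using nat_trans_natural[OF \<phi> E G l, of _ "(k, s)"] x' by auto
    moreover have "oper G f (map l (map (\<lambda>\<phi>. \<phi> E (k, s)) \<phi>s)) = l (oper E f (map (\<lambda>\<phi>. \<phi> E (k, s)) \<phi>s))"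
      using l f arg[OF E x'(2,3)] by (auto simp: hom_def simp del: map_map)
    ultimately show "fop (fun_alg T A S) B f \<phi>s G (fmap (fprod (yoneda T B) S) E G l x) =
        fmap (R_alg :: ('f, 'a, 'a) ralg) E G l (fop (fun_alg T A S) B f \<phi>s E x)"
      by (simp add: x' fop_fun_alg E G s lk del: map_map)
  qed
  then show ?thesis by (simp add: fun_alg_simps pitchfork_def)
qed

lemma fstr_fun_alg:
  assumes B: "B \<in> A" and r: "r \<in> carrier B" and E: "E \<in> A" and k: "k \<in> hom T B E" and s: "s \<in> fob S E"
  shows "fstr (fun_alg T A S) B r E (k, s) = k r"
proof -
  have "k r \<in> carrier E" using k r by (auto simp: hom_def)
  then show ?thesis using assms by (simp add: fun_alg_def exp_transpose_apply)
qed

lemma proj_nat_trans: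
  assumes S: "is_functor T A S"
  shows "(\<lambda>B\<in>A. \<lambda>(r, s)\<in>carrier B \<times> fob S B. r)
    \<in> nat_trans T A (fprod (R_alg :: ('f, 'a, 'a) ralg) S) (R_alg :: ('f, 'a, 'a) ralg)"
proof (rule nat_transI, goal_cases)
  case (3 B D h x)
  then obtain r s where x: "x = (r, s)" "r \<in> carrier B" "s \<in> fob S B" by auto
  have "h r \<in> carrier D" using 3 x by (auto simp: hom_def)
  moreover have "fmap S B D h s \<in> fob S D" using 3 x S unfolding is_functor_def by blast
  ultimately show ?case using 3 x by simp
qed auto

lemma fstr_fun_alg_nat_trans:
  assumes S: "is_functor T A S"
  shows "fstr (fun_alg T A S) \<in> nat_trans T A (R_alg :: ('f, 'a, 'a) ralg) (fun_alg T A S)"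
proof -
  have "fstr (fun_alg T A S) \<in> nat_trans T A (R_alg :: ('f, 'a, 'a) ralg)
      (pitchfork T A S (R_alg :: ('f, 'a, 'a) ralg))"
    using exp_transpose_nat_trans[OF R_functor S proj_nat_trans[OF S]] by (simp add: fun_alg_def)
  then show ?thesis by (simp add: nat_trans_def fun_alg_simps)
qed

lemma fun_alg_ralg:
  assumes S: "is_functor T A S"
  shows "is_ralg T A (fun_alg T A S)"
proof -
  let ?X = "fun_alg T A S"
  have eqI: "\<phi> = \<psi>" if "\<phi> \<in> fob ?X B" "\<psi> \<in> fob ?X B"
      "\<And>E k s. E \<in> A \<Longrightarrow> k \<in> hom T B E \<Longrightarrow> s \<in> fob S E \<Longrightarrow> \<phi> E (k, s) = \<psi> E (k, s)" for \<phi> \<psi> B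
    using pitchfork_elt_eqI[of \<phi> S "R_alg :: ('f, 'a, 'a) ralg" B \<psi>] that
    by (simp add: fun_alg_simps)
  have mm: "fmap ?X B D h \<phi> \<in> fob ?X D"
    if "B \<in> A" "D \<in> A" "h \<in> hom T B D" "\<phi> \<in> fob ?X B" for B D h \<phi>
    using pitchfork_map_mem[OF S that(1-3), of \<phi> "R_alg :: ('f, 'a, 'a) ralg"] that(4)
    by (simp add: fun_alg_simps)
  have mem: "\<phi> E (k, s) \<in> carrier E"
    if "\<phi> \<in> fob ?X B" "E \<in> A" "k \<in> hom T B E" "s \<in> fob S E" for \<phi> B E k s
    using that nat_trans_mem[of \<phi> T A "fprod (yoneda T B) S" "R_alg :: ('f, 'a, 'a) ralg" E "(k, s)"]
    by (simp add: fun_alg_simps pitchfork_def)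
  have "is_functor T A ?X"
    using pitchfork_functor[OF S, of "R_alg :: ('f, 'a, 'a) ralg"]
    by (simp add: is_functor_def fun_alg_simps)
  moreover have "is_talg T (stage ?X B)" if B: "B \<in> A" for B
  proof -
    have val_mem: "tm_val (stage ?X B) \<rho> t \<in> fob ?X B"
      if "wf_tm T t" and \<rho>: "range \<rho> \<subseteq> fob ?X B" for \<rho> t
      using that(1)
    proof (induction t)
      case (Var n) then show ?case using \<rho> by auto
    next
      case (App f ts)
      then show ?case
        using fop_fun_alg_mem[OF S _ B, of f "map (tm_val (stage ?X B) \<rho>) ts"]
        by (auto simp: stage_def args_def)
    qed
    have val: "tm_val (stage ?X B) \<rho> t E (k, s) = tm_val E (\<lambda>n. \<rho> n E (k, s)) t"
      if "E \<in> A" "k \<in> hom T B E" "s \<in> fob S E" for \<rho> t E k s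
    proof (induction t)
      case (App f ts)
      then have "map (\<lambda>t. tm_val (stage ?X B) \<rho> t E (k, s)) ts = map (tm_val E (\<lambda>n. \<rho> n E (k, s))) ts"
        by auto
      moreover have "tm_val (stage ?X B) \<rho> (App f ts) E (k, s) =
          oper E f (map (\<lambda>t. tm_val (stage ?X B) \<rho> t E (k, s)) ts)"
        using that by (simp add: stage_def fop_fun_alg comp_def)
      ultimately show ?case by (simp only: tm_val.simps)
    qed simp
    have "tm_val (stage ?X B) \<rho> t = tm_val (stage ?X B) \<rho> u"
      if tu: "(t, u) \<in> eqns T" and \<rho>: "range \<rho> \<subseteq> fob ?X B" for t u \<rho>
    proof (rule eqI)
      have "wf_tm T t" "wf_tm T u" using wf tu by (auto simp: wf_theory_def)
      then show "tm_val (stage ?X B) \<rho> t \<in> fob ?X B" "tm_val (stage ?X B) \<rho> u \<in> fob ?X B"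
        using val_mem \<rho> by blast+
      fix E k s assume *: "E \<in> A" "k \<in> hom T B E" "s \<in> fob S E"
      have "range (\<lambda>n. \<rho> n E (k, s)) \<subseteq> carrier E" using mem * \<rho> by blast
      then have "tm_val E (\<lambda>n. \<rho> n E (k, s)) t = tm_val E (\<lambda>n. \<rho> n E (k, s)) u"
        using alg[OF *(1)] tu unfolding is_talg_def by blast
      then show "tm_val (stage ?X B) \<rho> t E (k, s) = tm_val (stage ?X B) \<rho> u E (k, s)"
        by (simp add: val[OF *])
    qed
    then show ?thesis
      using fop_fun_alg_mem[OF S _ B] by (auto simp: is_talg_def stage_def)
  qed
  moreover have "restrict (fmap ?X B D h) (fob ?X B) \<in> hom T (stage ?X B) (stage ?X D)"
    if B: "B \<in> A" and D: "D \<in> A" and h: "h \<in> hom T B D" for B D h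
  proof -
    have "fmap ?X B D h (fop ?X B f xs) = fop ?X D f (map (restrict (fmap ?X B D h) (fob ?X B)) xs)"
      if f: "f \<in> ops T" and xs: "xs \<in> args T f (fob ?X B)" for f xs
    proof (rule eqI)
      have map_eq: "map (restrict (fmap ?X B D h) (fob ?X B)) xs = map (fmap ?X B D h) xs"
        using xs by (auto simp: args_def)
      show "fmap ?X B D h (fop ?X B f xs) \<in> fob ?X D"
        by (rule mm[OF B D h fop_fun_alg_mem[OF S f B xs]])
      have "map (fmap ?X B D h) xs \<in> args T f (fob ?X D)"
        using xs mm[OF B D h] by (auto simp: args_def)
      then show "fop ?X D f (map (restrict (fmap ?X B D h) (fob ?X B)) xs) \<in> fob ?X D"
        unfolding map_eq by (rule fop_fun_alg_mem[OF S f D])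
      fix E k s assume E: "E \<in> A" and k: "k \<in> hom T D E" and s: "s \<in> fob S E"
      show "fmap ?X B D h (fop ?X B f xs) E (k, s) =
          fop ?X D f (map (restrict (fmap ?X B D h) (fob ?X B)) xs) E (k, s)"
        unfolding map_eq
        by (simp add: fop_fun_alg E k s compose_hom[OF h k alg[OF B]] fun_alg_simps(2)
            pitchfork_fmap comp_def)
    qed
    then show ?thesis
      using mm[OF B D h] fop_fun_alg_mem[OF S _ B] by (auto simp: hom_def stage_def)
  qed
  moreover have "(\<lambda>B\<in>A. restrict (fstr ?X B) (carrier B)) = fstr ?X"
    by (auto simp: fun_alg_def exp_transpose_def fun_eq_iff)
  moreover have "restrict (fstr ?X B) (carrier B) \<in> hom T B (stage ?X B)" if B: "B \<in> A" for B
  proof -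
    have m: "fstr ?X B r \<in> fob ?X B" if "r \<in> carrier B" for r
      using nat_trans_mem[OF fstr_fun_alg_nat_trans[OF S] B] that by simp
    have "fstr ?X B (oper B f rs) = fop ?X B f (map (restrict (fstr ?X B) (carrier B)) rs)"
      if f: "f \<in> ops T" and rs: "rs \<in> args T f (carrier B)" for f rs
    proof (rule eqI)
      have map_eq: "map (restrict (fstr ?X B) (carrier B)) rs = map (fstr ?X B) rs"
        using rs by (auto simp: args_def)
      have o: "oper B f rs \<in> carrier B" using alg[OF B] f rs by (auto simp: is_talg_def)
      show "fstr ?X B (oper B f rs) \<in> fob ?X B" by (rule m[OF o])
      have "map (fstr ?X B) rs \<in> args T f (fob ?X B)" using rs m by (auto simp: args_def)
      then show "fop ?X B f (map (restrict (fstr ?X B) (carrier B)) rs) \<in> fob ?X B"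
        unfolding map_eq by (rule fop_fun_alg_mem[OF S f B])
      fix E k s assume E: "E \<in> A" and k: "k \<in> hom T B E" and s: "s \<in> fob S E"
      have "map ((\<lambda>\<phi>. \<phi> E (k, s)) \<circ> fstr ?X B) rs = map k rs"
        using rs fstr_fun_alg[OF B _ E k s] by (auto simp: args_def)
      moreover have "k (oper B f rs) = oper E f (map k rs)" using k f rs by (auto simp: hom_def)
      ultimately show "fstr ?X B (oper B f rs) E (k, s) =
          fop ?X B f (map (restrict (fstr ?X B) (carrier B)) rs) E (k, s)"
        unfolding map_eq fop_fun_alg[OF E k s] fstr_fun_alg[OF B o E k s] map_map by metis
    qed
    moreover have "oper B f rs \<in> carrier B" if "f \<in> ops T" "rs \<in> args T f (carrier B)" for f rs
      using alg[OF B] that by (auto simp: is_talg_def)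
    ultimately show ?thesis using m by (auto simp: hom_def stage_def)
  qed
  ultimately show ?thesis
    using fstr_fun_alg_nat_trans[OF S] unfolding is_ralg_def is_talg_functor_def by auto
qed

lemma pitchfork_R_functor:
  assumes X: "is_ralg T A X"
  shows "is_functor T A (pitchfork_R T A X Z)"
proof -
  have Xf: "is_functor T A X" using X by (simp add: is_ralg_def is_talg_functor_def)
  have "ralg_morphism_in_snd T A (yoneda T D) X Z (fmap (pitchfork T A X Z) B D h \<phi>)"
    if B: "B \<in> A" and D: "D \<in> A" and h: "h \<in> hom T B D"
      and m: "ralg_morphism_in_snd T A (yoneda T B) X Z \<phi>" for B D h \<phi>
    unfolding ralg_morphism_in_snd_def
  proof (intro ballI conjI)
    fix E k assume E: "E \<in> A" and k: "k \<in> fob (yoneda T D) E"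
    have k': "k \<in> hom T D E" using k by simp
    have kh: "compose (carrier B) k h \<in> hom T B E" by (rule compose_hom[OF h k' alg[OF B]])
    show "fmap (pitchfork T A X Z) B D h \<phi> E (k, fop X E f xs) =
        fop Z E f (map (\<lambda>x. fmap (pitchfork T A X Z) B D h \<phi> E (k, x)) xs)"
      if f: "f \<in> ops T" and xs: "xs \<in> args T f (fob X E)" for f xs
    proof -
      have "fop X E f xs \<in> fob X E"
        using X E f xs by (auto simp: is_ralg_def is_talg_functor_def is_talg_def stage_def)
      moreover have "map (\<lambda>x. fmap (pitchfork T A X Z) B D h \<phi> E (k, x)) xs =
          map (\<lambda>x. \<phi> E (compose (carrier B) k h, x)) xs"
        using xs by (auto simp: args_def pitchfork_fmap E k')
      moreover have "\<phi> E (compose (carrier B) k h, fop X E f xs) =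
          fop Z E f (map (\<lambda>x. \<phi> E (compose (carrier B) k h, x)) xs)"
        using m E kh f xs unfolding ralg_morphism_in_snd_def by simp
      ultimately show ?thesis by (simp only: pitchfork_fmap[OF E k'])
    qed
    show "fmap (pitchfork T A X Z) B D h \<phi> E (k, fstr X E r) = fstr Z E r" if r: "r \<in> carrier E" for r
    proof -
      have "restrict (fstr X E) (carrier E) \<in> hom T E (stage X E)"
        using X E by (simp add: is_ralg_def)
      then have "fstr X E r \<in> fob X E" using r by (auto simp: hom_def stage_def)
      moreover have "\<phi> E (compose (carrier B) k h, fstr X E r) = fstr Z E r"
        using m E kh r unfolding ralg_morphism_in_snd_def by simp
      ultimately show ?thesis by (simp add: pitchfork_fmap E k')
    qed
  qed
  then show ?thesis
    using pitchfork_functor[OF Xf, of Z] unfolding is_functor_def pitchfork_R_def by simp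
qed

lemma factors_through_pitchfork_R_iff:
  assumes P: "is_functor T A P" and X: "is_ralg T A X"
    and \<tau>: "\<tau> \<in> nat_trans T A (fprod P X) Z"
  shows "exp_transpose T A P X \<tau> \<in> nat_trans T A P (pitchfork_R T A X Z) \<longleftrightarrow>
    ralg_morphism_in_snd T A P X Z \<tau>"
proof -
  have Xf: "is_functor T A X" using X by (simp add: is_ralg_def is_talg_functor_def)
  have op: "fop X E f xs \<in> fob X E" if "E \<in> A" "f \<in> ops T" "xs \<in> args T f (fob X E)" for E f xs
    using X that by (auto simp: is_ralg_def is_talg_functor_def is_talg_def stage_def)
  have str: "fstr X E r \<in> fob X E" if "E \<in> A" "r \<in> carrier E" for E r
  proof -
    have "restrict (fstr X E) (carrier E) \<in> hom T E (stage X E)"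
      using X that by (simp add: is_ralg_def)
    then show ?thesis using that by (auto simp: hom_def stage_def)
  qed
  let ?\<sigma> = "exp_transpose T A P X \<tau>"
  have mp: "map (\<lambda>x. ?\<sigma> B p E (k, x)) xs = map (\<lambda>x. \<tau> E (fmap P B E k p, x)) xs"
    if "B \<in> A" "p \<in> fob P B" "E \<in> A" "k \<in> hom T B E" "xs \<in> args T f (fob X E)" for B p E k xs f
    using that by (auto simp: args_def exp_transpose_apply)
  have iff: "?\<sigma> \<in> nat_trans T A P (pitchfork_R T A X Z) \<longleftrightarrow>
      (\<forall>B\<in>A. \<forall>p\<in>fob P B. ralg_morphism_in_snd T A (yoneda T B) X Z (?\<sigma> B p))"
  proof
    assume "?\<sigma> \<in> nat_trans T A P (pitchfork_R T A X Z)"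
    then show "\<forall>B\<in>A. \<forall>p\<in>fob P B. ralg_morphism_in_snd T A (yoneda T B) X Z (?\<sigma> B p)"
      by (auto dest: nat_trans_mem simp: pitchfork_R_def)
  next
    assume *: "\<forall>B\<in>A. \<forall>p\<in>fob P B. ralg_morphism_in_snd T A (yoneda T B) X Z (?\<sigma> B p)"
    have \<sigma>: "?\<sigma> \<in> nat_trans T A P (pitchfork T A X Z)" by (rule exp_transpose_nat_trans[OF P Xf \<tau>])
    show "?\<sigma> \<in> nat_trans T A P (pitchfork_R T A X Z)"
    proof (rule nat_transI)
      fix B assume B: "B \<in> A"
      show "?\<sigma> B \<in> fob P B \<rightarrow>\<^sub>E fob (pitchfork_R T A X Z) B"
        using * B nat_trans_mem[OF \<sigma> B] by (auto simp: pitchfork_R_def exp_transpose_def)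
    qed (use nat_trans_natural[OF \<sigma>] in \<open>auto simp: pitchfork_R_def exp_transpose_def\<close>)
  qed
  show ?thesis
    unfolding iff
  proof
    assume *: "\<forall>B\<in>A. \<forall>p\<in>fob P B. ralg_morphism_in_snd T A (yoneda T B) X Z (?\<sigma> B p)"
    show "ralg_morphism_in_snd T A P X Z \<tau>"
      unfolding ralg_morphism_in_snd_def
    proof (intro ballI conjI)
      fix E p assume E: "E \<in> A" and p: "p \<in> fob P E"
      have i: "ident E \<in> hom T E E" by (rule ident_hom[OF alg[OF E]])
      have ip: "fmap P E E (ident E) p = p" using P E p unfolding is_functor_def by blast
      have r: "ralg_morphism_in_snd T A (yoneda T E) X Z (?\<sigma> E p)" using * E p by blast
      show "\<tau> E (p, fop X E f xs) = fop Z E f (map (\<lambda>x. \<tau> E (p, x)) xs)"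
        if f: "f \<in> ops T" and xs: "xs \<in> args T f (fob X E)" for f xs
      proof -
        have "?\<sigma> E p E (ident E, fop X E f xs) = fop Z E f (map (\<lambda>x. ?\<sigma> E p E (ident E, x)) xs)"
          using r E i f xs unfolding ralg_morphism_in_snd_def by simp
        then show ?thesis
          unfolding mp[OF E p E i xs] by (simp add: exp_transpose_apply E p i op f xs ip)
      qed
      show "\<tau> E (p, fstr X E r') = fstr Z E r'" if r': "r' \<in> carrier E" for r'
      proof -
        have "?\<sigma> E p E (ident E, fstr X E r') = fstr Z E r'"
          using r E i r' unfolding ralg_morphism_in_snd_def by simp
        then show ?thesis by (simp add: exp_transpose_apply E p i str r' ip)
      qed
    qed
  next
    assume *: "ralg_morphism_in_snd T A P X Z \<tau>"
    show "\<forall>B\<in>A. \<forall>p\<in>fob P B. ralg_morphism_in_snd T A (yoneda T B) X Z (?\<sigma> B p)"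
      unfolding ralg_morphism_in_snd_def[of T A "yoneda T _"]
    proof (intro ballI conjI)
      fix B p E k assume B: "B \<in> A" and p: "p \<in> fob P B" and E: "E \<in> A" and "k \<in> fob (yoneda T B) E"
      then have k: "k \<in> hom T B E" by simp
      have kp: "fmap P B E k p \<in> fob P E" using P B E k p unfolding is_functor_def by blast
      show "?\<sigma> B p E (k, fop X E f xs) = fop Z E f (map (\<lambda>x. ?\<sigma> B p E (k, x)) xs)"
        if f: "f \<in> ops T" and xs: "xs \<in> args T f (fob X E)" for f xs
        unfolding mp[OF B p E k xs]
        using * E kp f xs
        by (simp add: exp_transpose_apply B p E k op ralg_morphism_in_snd_def)
      show "?\<sigma> B p E (k, fstr X E r) = fstr Z E r" if r: "r \<in> carrier E" for r
        using * E kp r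
        by (simp add: exp_transpose_apply B p E k str ralg_morphism_in_snd_def)
    qed
  qed
qed

lemma dirac_nat_trans:
  assumes S: "is_functor T A S"
  shows "dirac T A S \<in> nat_trans T A S
    (pitchfork_R T A (fun_alg T A S) (R_alg :: ('f, 'a, 'a) ralg))"
proof -
  let ?X = "fun_alg T A S"
  let ?\<tau> = "\<lambda>B\<in>A. \<lambda>(s, \<phi>)\<in>fob S B \<times> fob ?X B.
    evaluation T A S (R_alg :: ('f, 'a, 'a) ralg) B (\<phi>, s)"
  have X: "is_ralg T A ?X" by (rule fun_alg_ralg[OF S])
  have Xf: "is_functor T A ?X" using X by (simp add: is_ralg_def is_talg_functor_def)
  have ev: "evaluation T A S (R_alg :: ('f, 'a, 'a) ralg) \<in> nat_trans T A
      (fprod (pitchfork T A S (R_alg :: ('f, 'a, 'a) ralg)) S) (R_alg :: ('f, 'a, 'a) ralg)"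
    by (rule evaluation_nat_trans[OF S])
  have \<tau>: "?\<tau> \<in> nat_trans T A (fprod S ?X) (R_alg :: ('f, 'a, 'a) ralg)"
  proof (rule nat_transI, goal_cases)
    case (1 B)
    then show ?case using nat_trans_mem[OF ev 1] by (auto simp: fun_alg_simps)
  next
    case (3 B D h x)
    then obtain s \<phi> where x: "x = (s, \<phi>)" "s \<in> fob S B" "\<phi> \<in> fob ?X B" by auto
    have "fmap S B D h s \<in> fob S D" using S 3 x unfolding is_functor_def by blast
    moreover have "fmap ?X B D h \<phi> \<in> fob ?X D" using Xf 3 x unfolding is_functor_def by blast
    ultimately show ?case
      using nat_trans_natural[OF ev 3(1-3), of "(\<phi>, s)"] 3 x by (simp add: fun_alg_simps)
  qed auto
  have t: "?\<tau> E (s, \<phi>) = \<phi> E (ident E, s)" if "E \<in> A" "s \<in> fob S E" "\<phi> \<in> fob ?X E" for E s \<phi>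
    using that by (simp add: evaluation_def fun_alg_simps)
  have "ralg_morphism_in_snd T A S ?X (R_alg :: ('f, 'a, 'a) ralg) ?\<tau>"
    unfolding ralg_morphism_in_snd_def
  proof (intro ballI conjI)
    fix E s assume E: "E \<in> A" and s: "s \<in> fob S E"
    have i: "ident E \<in> hom T E E" by (rule ident_hom[OF alg[OF E]])
    show "?\<tau> E (s, fop ?X E f \<phi>s) = fop R_alg E f (map (\<lambda>\<phi>. ?\<tau> E (s, \<phi>)) \<phi>s)"
      if f: "f \<in> ops T" and \<phi>s: "\<phi>s \<in> args T f (fob ?X E)" for f \<phi>s
    proof -
      have "map (\<lambda>\<phi>. ?\<tau> E (s, \<phi>)) \<phi>s = map (\<lambda>\<phi>. \<phi> E (ident E, s)) \<phi>s"
      proof (rule map_cong[OF refl])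
        fix \<phi> assume "\<phi> \<in> set \<phi>s"
        then have "\<phi> \<in> fob ?X E" using \<phi>s by (auto simp: args_def)
        then show "?\<tau> E (s, \<phi>) = \<phi> E (ident E, s)" by (rule t[OF E s])
      qed
      then show ?thesis
        unfolding t[OF E s fop_fun_alg_mem[OF S f E \<phi>s]] by (simp only: fop_fun_alg[OF E i s] R_alg_simps)
    qed
    show "?\<tau> E (s, fstr ?X E r) = fstr R_alg E r" if r: "r \<in> carrier E" for r
    proof -
      have "fstr ?X E r \<in> fob ?X E"
        using nat_trans_mem[OF fstr_fun_alg_nat_trans[OF S] E] r by simp
      from t[OF E s this] show ?thesis
        using r by (simp only: fstr_fun_alg[OF E r E i s] R_alg_simps) (simp add: ident_def)
    qed
  qed
  then show ?thesis
    using factors_through_pitchfork_R_iff[OF S X \<tau>] unfolding dirac_def by blast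
qed

end

end

theory Submission
  imports Defs
begin

text \<open>
  An element \<open>\<phi>\<close> of \<open>(y(C) \<pitchfork> R)(E)\<close> is a natural map \<open>y(E) \<times> y(C) \<rightarrow> R\<close>. Since \<open>y(E) \<times> y(C)\<close> is
  represented by the coproduct \<open>E + C\<close>, Yoneda identifies the algebra \<open>(y(C) \<pitchfork> R)(E)\<close> with \<open>E + C\<close>,
  with the structure map from \<open>E\<close> as first injection and \<open>c \<mapsto> (evaluation at c)\<close> as second.
  An \<open>R\<close>-algebra morphism out of it is thus determined by a homomorphism on \<open>C\<close>, and this
  homomorphism is the preimage under the Dirac map.
\<close>

section \<open>Extensional homomorphisms and objectwise isomorphisms\<close>

lemma hom_mem: "h \<in> hom T B D \<Longrightarrow> x \<in> carrier B \<Longrightarrow> h x \<in> carrier D"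
  by (auto simp: hom_def)

lemma hom_oper:
  "h \<in> hom T B D \<Longrightarrow> f \<in> ops T \<Longrightarrow> xs \<in> args T f (carrier B) \<Longrightarrow>
   h (oper B f xs) = oper D f (map h xs)"
  by (auto simp: hom_def)

lemma hom_eqI:
  assumes "h \<in> hom T B D" "k \<in> hom T B E" "\<And>x. x \<in> carrier B \<Longrightarrow> h x = k x"
  shows "h = k"
  using assms by (auto simp: hom_def PiE_def intro: extensionalityI)

text \<open>Objectwise inverses are automatically natural: naturality of \<open>\<eta>\<close> at
  \<open>\<theta> B y\<close> can be cancelled on the left by \<open>\<theta> D\<close>. The
  restrictions in \<open>\<theta>\<close> supply the extensionality that \<open>nat_trans\<close>
  demands.\<close>

lemma is_iso_if_bij_betw:
  assumes F: "is_functor T A F" and \<eta>: "\<eta> \<in> nat_trans T A F G"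
    and bij: "\<And>B. B \<in> A \<Longrightarrow> bij_betw (\<eta> B) (fob F B) (fob G B)"
  shows "is_iso T A F G \<eta>"
proof -
  define \<theta> where "\<theta> = (\<lambda>B\<in>A. \<lambda>y\<in>fob G B. inv_into (fob F B) (\<eta> B) y)"
  have \<theta>\<eta>: "\<theta> B (\<eta> B x) = x" if "B \<in> A" "x \<in> fob F B" for B x
    using bij_betw_inv_into_left[OF bij] that nat_trans_mem[OF \<eta> that] by (simp add: \<theta>_def)
  have \<eta>\<theta>: "\<eta> B (\<theta> B y) = y" if "B \<in> A" "y \<in> fob G B" for B y
    using bij_betw_inv_into_right[OF bij] that by (simp add: \<theta>_def)
  have mem: "\<theta> B y \<in> fob F B" if "B \<in> A" "y \<in> fob G B" for B y
    using bij_betwE[OF bij_betw_inv_into[OF bij]] that by (simp add: \<theta>_def)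
  have "\<theta> \<in> nat_trans T A G F"
  proof (rule nat_transI)
    fix B assume B: "B \<in> A"
    then show "\<theta> B \<in> fob G B \<rightarrow>\<^sub>E fob F B" using mem by (auto simp: \<theta>_def)
  next
    fix B D h y assume B: "B \<in> A" and D: "D \<in> A" and h: "h \<in> hom T B D" and y: "y \<in> fob G B"
    have Fh: "fmap F B D h (\<theta> B y) \<in> fob F D"
      using F B D h mem[OF B y] unfolding is_functor_def by blast
    show "\<theta> D (fmap G B D h y) = fmap F B D h (\<theta> B y)"
      using nat_trans_natural[OF \<eta> B D h mem[OF B y]] \<theta>\<eta>[OF D Fh] \<eta>\<theta>[OF B y] by simp
  qed (simp add: \<theta>_def)
  moreover have "nt_comp A F \<theta> \<eta> = nt_id A F"
    unfolding nt_comp_def nt_id_def using \<theta>\<eta> by (intro restrict_ext) auto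
  moreover have "nt_comp A G \<eta> \<theta> = nt_id A G"
    unfolding nt_comp_def nt_id_def using \<eta>\<theta> by (intro restrict_ext) auto
  ultimately show ?thesis using \<eta> unfolding is_iso_def by blast
qed

section \<open>Binary coproducts of algebras\<close>

definition is_binary_coproduct ::
  "'f alg_theory \<Rightarrow> ('f, 'a) alg \<Rightarrow> ('f, 'a) alg \<Rightarrow> ('f, 'a) alg \<Rightarrow>
   ('a \<Rightarrow> 'a) \<Rightarrow> ('a \<Rightarrow> 'a) \<Rightarrow> bool" where
  "is_binary_coproduct T B C P i j \<longleftrightarrow> i \<in> hom T B P \<and> j \<in> hom T C P \<and>
     (\<forall>(D :: ('f, 'a) alg) u v. is_talg T D \<and> u \<in> hom T B D \<and> v \<in> hom T C D \<longrightarrow>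
        (\<exists>!h. h \<in> hom T P D \<and> compose (carrier B) h i = u \<and> compose (carrier C) h j = v))"

lemma is_coproduct_pair:
  fixes T :: "'f alg_theory" and P :: "('f, 'a) alg"
  assumes P: "is_coproduct T [B, C] P \<iota>"
  shows "is_binary_coproduct T B C P (\<iota> 0) (\<iota> 1)"
proof -
  have all2: "(\<forall>n<length [B, C]. Q n) \<longleftrightarrow> Q 0 \<and> Q 1" for Q :: "nat \<Rightarrow> bool"
    by (auto simp: less_Suc_eq)
  have "\<exists>!h. h \<in> hom T P D \<and> compose (carrier B) h (\<iota> 0) = u \<and> compose (carrier C) h (\<iota> 1) = v"
    if "is_talg T D" "u \<in> hom T B D" "v \<in> hom T C D" for D :: "('f, 'a) alg" and u v
  proof -
    have "\<forall>g :: nat \<Rightarrow> 'a \<Rightarrow> 'a. is_talg T D \<and> (g 0 \<in> hom T B D \<and> g 1 \<in> hom T C D) \<longrightarrow>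
        (\<exists>!h. h \<in> hom T P D \<and>
          compose (carrier B) h (\<iota> 0) = g 0 \<and> compose (carrier C) h (\<iota> 1) = g 1)"
      using P unfolding is_coproduct_def all2 by simp
    \<comment> \<open>The pair of legs is coded as a family on the naturals; only its values at 0
      and 1 are inspected.\<close>
    from this[rule_format, of "\<lambda>n. if n = 0 then u else v"] that show ?thesis by simp
  qed
  moreover have "\<iota> 0 \<in> hom T B P" "\<iota> 1 \<in> hom T C P"
    using P unfolding is_coproduct_def all2 by auto
  ultimately show ?thesis unfolding is_binary_coproduct_def by blast
qed

section \<open>Elements of \<open>y(C) \<pitchfork> R\<close> as natural families\<close>

context algebra_subcategory
begin

lemma fun_alg_yoneda_apply_mem:
  assumes "\<phi> \<in> fob (fun_alg T A (yoneda T C)) B"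
    and "E \<in> A" "k \<in> hom T B E" "g \<in> hom T C E"
  shows "\<phi> E (k, g) \<in> carrier E"
  using nat_trans_mem[of \<phi> T A "fprod (yoneda T B) (yoneda T C)"
      "R_alg :: ('f, 'a, 'a) ralg" E "(k, g)"] assms
  by (simp add: fun_alg_simps pitchfork_def)

lemma fun_alg_yoneda_natural:
  assumes "\<phi> \<in> fob (fun_alg T A (yoneda T C)) B"
    and "E \<in> A" "G \<in> A" "l \<in> hom T E G" "k \<in> hom T B E" "g \<in> hom T C E"
  shows "\<phi> G (compose (carrier B) l k, compose (carrier C) l g) = l (\<phi> E (k, g))"
  using nat_trans_natural[of \<phi> T A "fprod (yoneda T B) (yoneda T C)"
      "R_alg :: ('f, 'a, 'a) ralg" E G l "(k, g)"] assms
  by (simp add: fun_alg_simps pitchfork_def)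

lemma fun_alg_eqI:
  assumes "\<phi> \<in> fob (fun_alg T A S) B" "\<psi> \<in> fob (fun_alg T A S) B"
    and "\<And>E k s. E \<in> A \<Longrightarrow> k \<in> hom T B E \<Longrightarrow> s \<in> fob S E \<Longrightarrow> \<phi> E (k, s) = \<psi> E (k, s)"
  shows "\<phi> = \<psi>"
  using pitchfork_elt_eqI[of \<phi> S "R_alg :: ('f, 'a, 'a) ralg" B \<psi>] assms
  by (simp add: fun_alg_simps)

text \<open>Once \<open>\<phi>\<close> has this extensional form, only values in the carriers and
  naturality remain to be checked. It serves both for evaluations at elements of \<open>C\<close>
  and for families of copairings.\<close>

lemma fun_alg_yonedaI:
  assumes B: "B \<in> A" and C: "C \<in> A"
    and \<phi>: "\<phi> = (\<lambda>E\<in>A. \<lambda>(k, g)\<in>hom T B E \<times> hom T C E. t E k g)"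
    and mem: "\<And>E k g. E \<in> A \<Longrightarrow> k \<in> hom T B E \<Longrightarrow> g \<in> hom T C E \<Longrightarrow> t E k g \<in> carrier E"
    and nat: "\<And>E G l k g. E \<in> A \<Longrightarrow> G \<in> A \<Longrightarrow> l \<in> hom T E G \<Longrightarrow> k \<in> hom T B E \<Longrightarrow> g \<in> hom T C E \<Longrightarrow>
      t G (compose (carrier B) l k) (compose (carrier C) l g) = l (t E k g)"
  shows "\<phi> \<in> fob (fun_alg T A (yoneda T C)) B"
proof -
  have "\<phi> \<in> nat_trans T A (fprod (yoneda T B) (yoneda T C)) (R_alg :: ('f, 'a, 'a) ralg)"
  proof (rule nat_transI, goal_cases)
    case (3 E G l x)
    then obtain k g where x: "x = (k, g)" "k \<in> hom T B E" "g \<in> hom T C E" by auto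
    then show ?case
      using 3 compose_hom[OF x(2) 3(3) alg[OF B]] compose_hom[OF x(3) 3(3) alg[OF C]]
      by (simp add: \<phi> nat)
  qed (auto simp: \<phi> mem)
  then show ?thesis by (simp add: fun_alg_simps pitchfork_def)
qed

text \<open>This is the projection \<open>y(B) \<times> y(C) \<rightarrow> y(C)\<close> followed by
  the map \<open>y(C) \<rightarrow> R\<close> that Yoneda assigns to \<open>c\<close>.\<close>

definition eval_at ::
  "('f, 'a) alg \<Rightarrow> ('f, 'a) alg \<Rightarrow> 'a \<Rightarrow> ('f, 'a) alg \<Rightarrow> ('a \<Rightarrow> 'a) \<times> ('a \<Rightarrow> 'a) \<Rightarrow> 'a" where
  "eval_at C B c = (\<lambda>E\<in>A. \<lambda>(k, g)\<in>hom T B E \<times> hom T C E. g c)"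

lemma eval_at_apply:
  "E \<in> A \<Longrightarrow> k \<in> hom T B E \<Longrightarrow> g \<in> hom T C E \<Longrightarrow> eval_at C B c E (k, g) = g c"
  by (simp add: eval_at_def)

lemma eval_at_mem:
  assumes "B \<in> A" "C \<in> A" "c \<in> carrier C"
  shows "eval_at C B c \<in> fob (fun_alg T A (yoneda T C)) B"
  by (rule fun_alg_yonedaI[OF assms(1,2) eval_at_def])
    (use assms(3) in \<open>auto simp: hom_mem compose_def\<close>)

text \<open>A transition map only precomposes the first argument \<open>k\<close>, which
  \<open>eval_at\<close> ignores.\<close>

lemma fmap_eval_at:
  assumes B: "B \<in> A" and D: "D \<in> A" and C: "C \<in> A" and c: "c \<in> carrier C" and h: "h \<in> hom T B D"
  shows "fmap (fun_alg T A (yoneda T C)) B D h (eval_at C B c) = eval_at C D c"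
proof (rule fun_alg_eqI[OF _ eval_at_mem[OF D C c]])
  show "fmap (fun_alg T A (yoneda T C)) B D h (eval_at C B c) \<in> fob (fun_alg T A (yoneda T C)) D"
    using pitchfork_map_mem[OF yoneda_functor[OF alg C] B D h] eval_at_mem[OF B C c]
    by (simp add: fun_alg_simps)
  fix E k g assume E: "E \<in> A" and k: "k \<in> hom T D E" and "g \<in> fob (yoneda T C) E"
  then show "fmap (fun_alg T A (yoneda T C)) B D h (eval_at C B c) E (k, g) = eval_at C D c E (k, g)"
    using compose_hom[OF h k alg[OF B]]
    by (simp add: fun_alg_simps pitchfork_fmap eval_at_apply)
qed

text \<open>The transpose first moves \<open>s\<close> along \<open>k\<close> to stage
  \<open>E\<close>; evaluation there takes place at the identity of \<open>E\<close>.\<close>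

lemma dirac_yoneda_apply:
  assumes B: "B \<in> A" and C: "C \<in> A" and s: "s \<in> hom T C B"
    and E: "E \<in> A" and k: "k \<in> hom T B E" and \<phi>: "\<phi> \<in> fob (fun_alg T A (yoneda T C)) E"
  shows "dirac T A (yoneda T C) B s E (k, \<phi>) = \<phi> E (ident E, compose (carrier C) k s)"
  using assms compose_hom[OF s k alg[OF C]]
  by (simp add: dirac_def exp_transpose_apply evaluation_def fun_alg_simps)

text \<open>The universal property of the coproduct \<open>E + C\<close>, transported along
  \<open>(y(C) \<pitchfork> R)(E) \<cong> E + C\<close>.\<close>

lemma ralg_hom_fun_alg_yoneda:
  assumes E: "E \<in> A" and C: "C \<in> A"
    and P: "P \<in> A" "is_binary_coproduct T E C P i j"
    and \<Psi>_mem: "\<And>\<phi>. \<phi> \<in> fob (fun_alg T A (yoneda T C)) E \<Longrightarrow> \<Psi> \<phi> \<in> carrier E"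
    and \<Psi>_oper: "\<And>f \<phi>s. f \<in> ops T \<Longrightarrow> \<phi>s \<in> args T f (fob (fun_alg T A (yoneda T C)) E) \<Longrightarrow>
      \<Psi> (fop (fun_alg T A (yoneda T C)) E f \<phi>s) = oper E f (map \<Psi> \<phi>s)"
    and \<Psi>_str: "\<And>r. r \<in> carrier E \<Longrightarrow> \<Psi> (fstr (fun_alg T A (yoneda T C)) E r) = r"
  defines "\<sigma> \<equiv> \<lambda>c\<in>carrier C. \<Psi> (eval_at C E c)"
  shows "\<sigma> \<in> hom T C E"
    and "\<phi> \<in> fob (fun_alg T A (yoneda T C)) E \<Longrightarrow> \<Psi> \<phi> = \<phi> E (ident E, \<sigma>)"
proof -
  let ?X = "fun_alg T A (yoneda T C)"
  have S: "is_functor T A (yoneda T C)" by (rule yoneda_functor[OF alg C])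
  have i: "i \<in> hom T E P" and j: "j \<in> hom T C P"
    and ex1: "\<And>(D :: ('f, 'a) alg) u v. is_talg T D \<Longrightarrow> u \<in> hom T E D \<Longrightarrow> v \<in> hom T C D \<Longrightarrow>
      \<exists>!h. h \<in> hom T P D \<and> compose (carrier E) h i = u \<and> compose (carrier C) h j = v"
    using P(2) unfolding is_binary_coproduct_def by blast+
  \<comment> \<open>\<open>cp D u v\<close> is the copairing \<open>[u, v]\<close> out of the
    coproduct \<open>P\<close>.\<close>
  define cp where "cp D u v =
    (THE h. h \<in> hom T P D \<and> compose (carrier E) h i = u \<and> compose (carrier C) h j = v)" for D :: "('f, 'a) alg" and u v
  have cp: "cp D u v \<in> hom T P D" "compose (carrier E) (cp D u v) i = u"
      "compose (carrier C) (cp D u v) j = v"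
    if "D \<in> A" "u \<in> hom T E D" "v \<in> hom T C D" for D u v
    using theI'[OF ex1[OF alg[OF that(1)] that(2,3)]] unfolding cp_def by auto
  have cp_eqI: "h = cp D u v"
    if "D \<in> A" "h \<in> hom T P D" "compose (carrier E) h i = u" "compose (carrier C) h j = v"
    for D h u v
  proof -
    have "u \<in> hom T E D" "v \<in> hom T C D"
      using compose_hom[OF i that(2) alg[OF E]] compose_hom[OF j that(2) alg[OF C]] that(3,4) by auto
    from the1_equality[OF ex1[OF alg[OF that(1)] this]] show ?thesis
      using that unfolding cp_def by simp
  qed
  \<comment> \<open>Both sides have the same composites with \<open>i\<close> and \<open>j\<close>.
    This is what makes the families \<open>\<Phi> p\<close> below natural.\<close>
  have cp_compose: "cp G (compose (carrier E) l k) (compose (carrier C) l g) =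
      compose (carrier P) l (cp D k g)"
    if *: "D \<in> A" "G \<in> A" "l \<in> hom T D G" "k \<in> hom T E D" "g \<in> hom T C D" for D G l k g
    using compose_hom[OF cp(1)[OF *(1,4,5)] *(3) alg[OF P(1)]]
    by (intro cp_eqI[symmetric, OF *(2)])
      (simp_all add: compose_assoc_hom[OF i, symmetric] compose_assoc_hom[OF j, symmetric] cp *)
  \<comment> \<open>The Yoneda map from \<open>P\<close> to \<open>(y(C) \<pitchfork> R)(E)\<close>:
    apply the copairing of each pair \<open>(k, g)\<close> to \<open>p\<close>.\<close>
  define \<Phi> where "\<Phi> p = (\<lambda>D\<in>A. \<lambda>(k, g)\<in>hom T E D \<times> hom T C D. cp D k g p)" for p
  have \<Phi>: "\<Phi> p D (k, g) = cp D k g p" if "D \<in> A" "k \<in> hom T E D" "g \<in> hom T C D" for p D k g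
    using that by (simp add: \<Phi>_def)
  have \<Phi>_mem: "\<Phi> p \<in> fob ?X E" if "p \<in> carrier P" for p
    by (rule fun_alg_yonedaI[OF E C \<Phi>_def])
      (use that in \<open>simp_all add: cp_compose compose_eq hom_mem[OF cp(1)]\<close>)
  have \<Phi>_oper: "\<Phi> (oper P f ps) = fop ?X E f (map \<Phi> ps)"
    if f: "f \<in> ops T" and ps: "ps \<in> args T f (carrier P)" for f ps
  proof (rule fun_alg_eqI)
    show "\<Phi> (oper P f ps) \<in> fob ?X E"
      using alg[OF P(1)] f ps by (intro \<Phi>_mem) (auto simp: is_talg_def)
    show "fop ?X E f (map \<Phi> ps) \<in> fob ?X E"
      using ps \<Phi>_mem by (intro fop_fun_alg_mem[OF S f E]) (auto simp: args_def)
    fix D k g assume *: "D \<in> A" "k \<in> hom T E D" "g \<in> fob (yoneda T C) D"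
    then show "\<Phi> (oper P f ps) D (k, g) = fop ?X E f (map \<Phi> ps) D (k, g)"
      using hom_oper[OF cp(1) f ps] by (simp add: fop_fun_alg \<Phi> comp_def)
  qed
  \<comment> \<open>Yoneda: \<open>(i, j)\<close> is the universal pair, every \<open>(k, g)\<close>
    being its image under \<open>cp D k g\<close>, so naturality determines \<open>\<phi>\<close>
    from its value there.\<close>
  have \<Phi>_surj: "\<Phi> (\<phi> P (i, j)) = \<phi>" if \<phi>: "\<phi> \<in> fob ?X E" for \<phi>
  proof (rule fun_alg_eqI[OF \<Phi>_mem \<phi>])
    show "\<phi> P (i, j) \<in> carrier P" by (rule fun_alg_yoneda_apply_mem[OF \<phi> P(1) i j])
    fix D k g assume D: "D \<in> A" and k: "k \<in> hom T E D" and "g \<in> fob (yoneda T C) D"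
    then have g: "g \<in> hom T C D" by simp
    show "\<Phi> (\<phi> P (i, j)) D (k, g) = \<phi> D (k, g)"
      using fun_alg_yoneda_natural[OF \<phi> P(1) D cp(1)[OF D k g] i j] by (simp add: \<Phi> cp D k g)
  qed
  have \<Phi>_i: "\<Phi> (i r) = fstr ?X E r" if r: "r \<in> carrier E" for r
  proof (rule fun_alg_eqI[OF \<Phi>_mem[OF hom_mem[OF i r]]])
    show "fstr ?X E r \<in> fob ?X E" using nat_trans_mem[OF fstr_fun_alg_nat_trans[OF S] E] r by simp
    fix D k g assume *: "D \<in> A" "k \<in> hom T E D" "g \<in> fob (yoneda T C) D"
    then show "\<Phi> (i r) D (k, g) = fstr ?X E r D (k, g)"
      using fun_cong[OF cp(2), of D k g r] r by (simp add: \<Phi> fstr_fun_alg E compose_eq)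
  qed
  have \<Phi>_j: "\<Phi> (j c) = eval_at C E c" if c: "c \<in> carrier C" for c
  proof (rule fun_alg_eqI[OF \<Phi>_mem[OF hom_mem[OF j c]] eval_at_mem[OF E C c]])
    fix D k g assume *: "D \<in> A" "k \<in> hom T E D" "g \<in> fob (yoneda T C) D"
    then show "\<Phi> (j c) D (k, g) = eval_at C E c D (k, g)"
      using fun_cong[OF cp(3), of D k g c] c by (simp add: \<Phi> eval_at_apply compose_eq)
  qed
  \<comment> \<open>Pulling \<open>\<Psi>\<close> back along \<open>\<Phi>\<close> gives a map
    between algebras with elements in \<open>'a\<close>, the only ones to which the universal
    property of \<open>P\<close> applies. Its legs turn out to be \<open>ident E\<close> and
    \<open>\<sigma>\<close>.\<close>
  define h where "h = (\<lambda>p\<in>carrier P. \<Psi> (\<Phi> p))"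
  have h: "h \<in> hom T P E"
  proof -
    have "h (oper P f ps) = oper E f (map h ps)"
      if f: "f \<in> ops T" and ps: "ps \<in> args T f (carrier P)" for f ps
    proof -
      have "map \<Phi> ps \<in> args T f (fob ?X E)" using ps \<Phi>_mem by (auto simp: args_def)
      moreover have "oper P f ps \<in> carrier P" using alg[OF P(1)] f ps by (auto simp: is_talg_def)
      moreover have "map h ps = map \<Psi> (map \<Phi> ps)" using ps by (auto simp: h_def args_def)
      ultimately show ?thesis
        using \<Psi>_oper[OF f, of "map \<Phi> ps"] by (simp add: h_def \<Phi>_oper[OF f ps] del: map_map)
    qed
    then show ?thesis using \<Psi>_mem \<Phi>_mem by (auto simp: hom_def h_def)
  qed
  have hi: "compose (carrier E) h i = ident E"
    unfolding compose_def ident_def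
    by (rule restrict_ext) (simp add: h_def hom_mem[OF i] \<Phi>_i \<Psi>_str)
  have hj: "compose (carrier C) h j = \<sigma>"
    unfolding compose_def \<sigma>_def
    by (rule restrict_ext) (simp add: h_def hom_mem[OF j] \<Phi>_j)
  show \<sigma>: "\<sigma> \<in> hom T C E" using compose_hom[OF j h alg[OF C]] by (simp add: hj)
  show "\<Psi> \<phi> = \<phi> E (ident E, \<sigma>)" if \<phi>: "\<phi> \<in> fob ?X E" for \<phi>
  proof -
    have p: "\<phi> P (i, j) \<in> carrier P" by (rule fun_alg_yoneda_apply_mem[OF \<phi> P(1) i j])
    have "\<Psi> \<phi> = h (\<phi> P (i, j))" using p by (simp add: h_def \<Phi>_surj[OF \<phi>])
    also have "\<dots> = \<Phi> (\<phi> P (i, j)) E (ident E, \<sigma>)"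
      \<comment> \<open>By uniqueness \<open>h\<close> is the copairing of \<open>ident E\<close>
        and \<open>\<sigma>\<close>, which is the component of \<open>\<Phi>\<close> at that
        pair.\<close>
      using cp_eqI[OF E h hi hj] by (simp add: \<Phi> E \<sigma> ident_hom alg)
    finally show ?thesis by (simp add: \<Phi>_surj[OF \<phi>])
  qed
qed

section \<open>Bijectivity of the Dirac map at each object\<close>

text \<open>Injectivity holds because testing on \<open>eval_at\<close> recovers \<open>s\<close>.
  For surjectivity, each \<open>k\<close> from \<open>B\<close> to \<open>E\<close> turns
  \<open>\<Theta>\<close> into an \<open>R\<close>-algebra morphism at stage \<open>E\<close>, hence
  into evaluation at some \<open>\<sigma> E k\<close>; naturality in \<open>k\<close> then leaves a
  single \<open>s\<close>.\<close>

lemma bij_betw_dirac_yoneda: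
  assumes cop: "closed_under_finite_coproducts T A" and B: "B \<in> A" and C: "C \<in> A"
  shows "bij_betw (dirac T A (yoneda T C) B) (hom T C B)
    (fob (pitchfork_R T A (fun_alg T A (yoneda T C)) (R_alg :: ('f, 'a, 'a) ralg)) B)"
proof -
  let ?X = "fun_alg T A (yoneda T C)"
  let ?\<delta> = "dirac T A (yoneda T C)"
  let ?Y = "pitchfork_R T A ?X (R_alg :: ('f, 'a, 'a) ralg)"
  have S: "is_functor T A (yoneda T C)" by (rule yoneda_functor[OF alg C])
  have idB: "ident B \<in> hom T B B" by (rule ident_hom[OF alg[OF B]])
  have \<delta>_mem: "?\<delta> B s \<in> fob ?Y B" if "s \<in> hom T C B" for s
    using nat_trans_mem[OF dirac_nat_trans[OF S] B] that by simp
  have recover: "?\<delta> B s B (ident B, eval_at C B c) = s c"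
    if s: "s \<in> hom T C B" and c: "c \<in> carrier C" for s c
    by (simp add: dirac_yoneda_apply B C s idB eval_at_mem c compose_ident_left[OF s] eval_at_apply)
  have "inj_on (?\<delta> B) (hom T C B)"
  proof (rule inj_onI)
    fix s s' assume s: "s \<in> hom T C B" and s': "s' \<in> hom T C B" and eq: "?\<delta> B s = ?\<delta> B s'"
    show "s = s'" by (rule hom_eqI[OF s s']) (metis recover s s' eq)
  qed
  moreover have "\<Theta> \<in> ?\<delta> B ` hom T C B" if "\<Theta> \<in> fob ?Y B" for \<Theta>
  proof -
    have \<Theta>: "\<Theta> \<in> fob (pitchfork T A ?X (R_alg :: ('f, 'a, 'a) ralg)) B"
      and mor: "ralg_morphism_in_snd T A (yoneda T B) ?X (R_alg :: ('f, 'a, 'a) ralg) \<Theta>"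
      using that by (auto simp: pitchfork_R_def)
    have nt: "\<Theta> \<in> nat_trans T A (fprod (yoneda T B) ?X) (R_alg :: ('f, 'a, 'a) ralg)"
      using \<Theta> by (simp add: pitchfork_def)
    define \<sigma> where "\<sigma> E k = (\<lambda>c\<in>carrier C. \<Theta> E (k, eval_at C E c))" for E k
    have \<sigma>: "\<sigma> E k \<in> hom T C E"
        "\<phi> \<in> fob ?X E \<Longrightarrow> \<Theta> E (k, \<phi>) = \<phi> E (ident E, \<sigma> E k)"
      if E: "E \<in> A" and k: "k \<in> hom T B E" for E k \<phi>
    proof -
      \<comment> \<open>Closure under coproducts enters here: the coproduct must lie in
        \<open>A\<close> for elements of \<open>(y(C) \<pitchfork> R)(E)\<close> to be evaluated at
        it.\<close>
      have "set [E, C] \<subseteq> A" using E C by simp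
      then obtain P \<iota> where P: "P \<in> A" "is_coproduct T [E, C] P \<iota>"
        using cop unfolding closed_under_finite_coproducts_def by blast
      have mem: "\<Theta> E (k, \<phi>) \<in> carrier E" if "\<phi> \<in> fob ?X E" for \<phi>
        using nat_trans_mem[OF nt E, of "(k, \<phi>)"] k that by simp
      have pres: "\<Theta> E (k, fop ?X E f \<phi>s) = oper E f (map (\<lambda>\<phi>. \<Theta> E (k, \<phi>)) \<phi>s)"
        if "f \<in> ops T" "\<phi>s \<in> args T f (fob ?X E)" for f \<phi>s
        using mor E k that unfolding ralg_morphism_in_snd_def by simp
      have str: "\<Theta> E (k, fstr ?X E r) = r" if "r \<in> carrier E" for r
        using mor E k that unfolding ralg_morphism_in_snd_def by simp
      note * = ralg_hom_fun_alg_yoneda[OF E C P(1) is_coproduct_pair[OF P(2)],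
          where \<Psi> = "\<lambda>\<phi>. \<Theta> E (k, \<phi>)", OF mem pres str, folded \<sigma>_def]
      show "\<sigma> E k \<in> hom T C E" by (rule *(1))
      show "\<phi> \<in> fob ?X E \<Longrightarrow> \<Theta> E (k, \<phi>) = \<phi> E (ident E, \<sigma> E k)" by (rule *(2))
    qed
    \<comment> \<open>The preimage is read off at the generic element \<open>ident B\<close> of
      \<open>y(B)\<close>.\<close>
    define s where "s = \<sigma> B (ident B)"
    have s: "s \<in> hom T C B" unfolding s_def by (rule \<sigma>(1)[OF B idB])
    \<comment> \<open>The transition along \<open>k\<close> carries
      \<open>(ident B, eval_at C B c)\<close> to \<open>(k, eval_at C E c)\<close>, so naturality of
      \<open>\<Theta>\<close> relates the two values.\<close>
    have \<sigma>_eq: "\<sigma> E k = compose (carrier C) k s" if E: "E \<in> A" and k: "k \<in> hom T B E" for E k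
    proof -
      have "\<Theta> E (k, eval_at C E c) = k (\<Theta> B (ident B, eval_at C B c))" if c: "c \<in> carrier C" for c
        using nat_trans_natural[OF nt B E k, of "(ident B, eval_at C B c)"]
        by (simp add: idB eval_at_mem B C c fmap_eval_at E k compose_ident_right[OF k])
      then show ?thesis by (auto simp: s_def \<sigma>_def compose_def fun_eq_iff)
    qed
    have "\<Theta> = ?\<delta> B s"
    proof (rule pitchfork_elt_eqI[OF \<Theta>])
      show "?\<delta> B s \<in> fob (pitchfork T A ?X (R_alg :: ('f, 'a, 'a) ralg)) B"
        using \<delta>_mem[OF s] by (simp add: pitchfork_R_def)
      fix E k \<phi> assume "E \<in> A" "k \<in> hom T B E" "\<phi> \<in> fob ?X E"
      then show "\<Theta> E (k, \<phi>) = ?\<delta> B s E (k, \<phi>)"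
        by (simp add: \<sigma>(2) \<sigma>_eq dirac_yoneda_apply B C s)
    qed
    then show ?thesis using s by blast
  qed
  ultimately show ?thesis using \<delta>_mem unfolding bij_betw_def by blast
qed

end

theorem theorem5:
  fixes T :: "'f alg_theory" and A :: "('f, 'a) alg set" and C :: "('f, 'a) alg"
  assumes "wf_theory T"
    and "\<And>B. B \<in> A \<Longrightarrow> is_talg T B"
    and "closed_under_finite_coproducts T A"
    and "C \<in> A"
  shows "is_iso T A (yoneda T C)
           (pitchfork_R T A (fun_alg T A (yoneda T C)) (R_alg :: ('f, 'a, 'a) ralg))
           (dirac T A (yoneda T C))"
proof -
  interpret algebra_subcategory T A by unfold_locales (use assms in auto)
  have S: "is_functor T A (yoneda T C)" by (rule yoneda_functor[OF alg assms(4)])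
  show ?thesis
    by (rule is_iso_if_bij_betw[OF S dirac_nat_trans[OF S]])
      (simp add: bij_betw_dirac_yoneda assms(3,4))
qed

end
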